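(* Let $A$ be a Hausdorff space with no isolated point and $S$ a pseudogroup on $A$. Let $X$ be a Hausdorff $S$-modeled space. Let $H$ be a subgroup of $\mathrm{PC}_S(X)$ such that $X$ is transfixed under the partial $S$-preserving action $\alpha_S$ restricted to $H$. Then there exists a cofinite subset $Y$ of $X$ such that the universal globalization $\hat{Y}_H$ of $Y$ (for the restricted partial action of $H$) is Hausdorff. In particular, $\hat{Y}_H$ is an $S$-modeled Hausdorff space, and the identity map of $Y$ is an $S$-preserving homeomorphism between cofinite subsets of $X$ and $\hat{Y}_H$, intertwining the parcelwise-$S$ action of $H$ on $X$ with an $S$-preserving action of $H$ on $\hat{Y}_H$.
   Context: Partial homeomorphisms: $\mathcal{I}_{\mathrm{top}}(A,B)$ is the set of homeomorphisms between an open subset of $A$ and an open subset of $B$, viewed as subsets of $A\times B$; these compose as partial maps; $\mathcal{I}_{\mathrm{top}}(A)=\mathcal{I}_{\mathrm{top}}(A,A)$; $u\subset v$ means $v$ extends $u$. Pseudogroup: a pseudogroup on $A$ is a subset $S\subset\mathcal{I}_{\mathrm{top}}(A)$ containing $\mathrm{id}_A$, stable under composition and $u\mapsto u^{-1}$, such that $\{U:\mathrm{id}_U\in S\}$ is a basis of the topology of $A$. $\hat S$ is the set of elements of $\mathcal{I}_{\mathrm{top}}(A)$ that are unions of elements of $S$. An $S$-atlas on a topological space $X$ is a subset $\mathcal{H}\subset\mathcal{I}_{\mathrm{top}}(X,A)$ (charts), with $\emptyset\in\mathcal{H}$, whose domains cover $X$, such that $g\circ f^{-1}\in\hat S$ for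 all $f,g\in\mathcal{H}$. It is complete if $u\circ f\in\mathcal H$ for all $f\in\mathcal H$, $u\in S$, and every union of elements of $\mathcal{H}$ that belongs to $\mathcal{I}_{\mathrm{top}}(X,A)$ is in $\mathcal{H}$. An $S$-structure on $X$ is a complete $S$-atlas (every $S$-atlas generates one), and $X$ is then called $S$-modeled. $\mathcal{I}_S(X)$, the set of $S$-preserving partial homeomorphisms, consists of elements of $\mathcal{I}_{\mathrm{top}}(X)$ that are unions of elements $g^{-1}\circ f$ with $f,g\in\mathcal{H}$ (and similarly between two $S$-modeled spaces). $\mathrm{PC}_S(X)$ is the group of $S$-preserving homeomorphisms between open cofinite subsets of $X$, two of these being identified when they agree on a cofinite subset. When $X$ is Hausdorff without isolated point, for $g\in\mathrm{PC}_S(X)$ the union $\alpha_S(g)$ (as subsets of $X^2$) of all $S$-preserving representatives of $g$ with open cofinite domain and range is itself a partial bijection, and $g\mapsto\alpha_S(g)$ is a partial action of $\mathrm{PC}_S(X)$ on $X$. Partial actions: a (topological) partial action of a discrete group $G$ on $X$ is a map $\alpha:G\to\mathcal{I}_{\mathrm{top}}(X)$ with $\alpha(1)=\mathrm{id}_X$, $\alpha(g^{-1})=\alpha(g)^{-1}$, $\alpha(g)\alpha(h)\subset\alpha(gh)$. It restricts to any open subset $Y$ by $g\mapsto\alpha(g)\cap Y^2$. Its universal globalization $\hat X=\hat X_G$ is the quotient of $G\times X$ by the relation $(h,x)\sim(k,y)$ iff $\alpha(k^{-1}h)(x)$ is defined and equals $y$, with quotient topology and the $G$-action induced by $g\cdot(h,x)=(gh,x)$;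 $X$ embeds as an open subset by $x\mapsto[(1,x)]$, and if the partial action is $S$-preserving (valued in $\mathcal{I}_S(X)$) then $\hat X$ carries a unique $G$-invariant $S$-structure extending that of $X$. $X$ is transfixed if there is a $G$-invariant subset $X_0\subset\hat X$ with $X\bigtriangleup X_0$ finite. *)

theory Defs
  imports "HOL-Analysis.Analysis" "HOL-Algebra.Group_Action"
begin

text \<open>
  Partial maps are relations (subsets of a product), spaces are abstract topologies with their own
  carrier.
\<close>

definition graph_on :: "'a set \<Rightarrow> ('a \<Rightarrow> 'b) \<Rightarrow> ('a \<times> 'b) set" where
  "graph_on U f = (\<lambda>x. (x, f x)) ` U"

definition I_top :: "'a topology \<Rightarrow> 'b topology \<Rightarrow> ('a \<times> 'b) set set" where
  "I_top A B = {u. \<exists>U V f. openin A U \<and> openin B V \<and>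
      homeomorphic_map (subtopology A U) (subtopology B V) f \<and> u = graph_on U f}"

text \<open>Composition in the order of functions: first \<open>u\<close>, then \<open>v\<close>.\<close>

abbreviation pcomp :: "('b \<times> 'c) set \<Rightarrow> ('a \<times> 'b) set \<Rightarrow> ('a \<times> 'c) set" (infixl "\<circ>\<^sub>p" 75) where
  "v \<circ>\<^sub>p u \<equiv> u O v"

definition pseudogroup :: "'a topology \<Rightarrow> ('a \<times> 'a) set set \<Rightarrow> bool" where
  "pseudogroup A S \<longleftrightarrow>
     S \<subseteq> I_top A A \<and> Id_on (topspace A) \<in> S \<and>
     (\<forall>u\<in>S. \<forall>v\<in>S. v \<circ>\<^sub>p u \<in> S) \<and> (\<forall>u\<in>S. u\<inverse> \<in> S) \<and>
     openin A = arbitrary union_of (\<lambda>U. Id_on U \<in> S)"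

definition S_hat :: "'a topology \<Rightarrow> ('a \<times> 'a) set set \<Rightarrow> ('a \<times> 'a) set set" where
  "S_hat A S = {u \<in> I_top A A. \<exists>F\<subseteq>S. u = \<Union>F}"

definition S_atlas ::
  "'a topology \<Rightarrow> ('a \<times> 'a) set set \<Rightarrow> 'x topology \<Rightarrow> ('x \<times> 'a) set set \<Rightarrow> bool" where
  "S_atlas A S X \<H> \<longleftrightarrow>
     \<H> \<subseteq> I_top X A \<and> {} \<in> \<H> \<and> \<Union>(Domain ` \<H>) = topspace X \<and>
     (\<forall>f\<in>\<H>. \<forall>g\<in>\<H>. g \<circ>\<^sub>p f\<inverse> \<in> S_hat A S)"

definition S_structure ::
  "'a topology \<Rightarrow> ('a \<times> 'a) set set \<Rightarrow> 'x topology \<Rightarrow> ('x \<times> 'a) set set \<Rightarrow> bool" where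
  "S_structure A S X \<H> \<longleftrightarrow>
     S_atlas A S X \<H> \<and>
     (\<forall>f\<in>\<H>. \<forall>u\<in>S. u \<circ>\<^sub>p f \<in> \<H>) \<and>
     (\<forall>F\<subseteq>\<H>. \<Union>F \<in> I_top X A \<longrightarrow> \<Union>F \<in> \<H>)"

text \<open>
  \<open>I_S X \<H> Y \<K>\<close> is the set of \<open>S\<close>-preserving partial homeomorphisms from \<open>X\<close> to \<open>Y\<close>; it depends
  on \<open>S\<close> only through the structures \<open>\<H>\<close> of \<open>X\<close> and \<open>\<K>\<close> of \<open>Y\<close>.
\<close>

definition I_S ::
  "'x topology \<Rightarrow> ('x \<times> 'a) set set \<Rightarrow> 'y topology \<Rightarrow> ('y \<times> 'a) set set \<Rightarrow> ('x \<times> 'y) set set" where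
  "I_S X \<H> Y \<K> = {u \<in> I_top X Y. \<exists>F \<subseteq> {g\<inverse> \<circ>\<^sub>p f | f g. f \<in> \<H> \<and> g \<in> \<K>}. u = \<Union>F}"

definition restrict_structure :: "('x \<times> 'a) set set \<Rightarrow> 'x set \<Rightarrow> ('x \<times> 'a) set set" where
  "restrict_structure \<H> Y = {f \<in> \<H>. Domain f \<subseteq> Y}"

definition cofinite_homeos :: "'x topology \<Rightarrow> ('x \<times> 'a) set set \<Rightarrow> ('x \<times> 'x) set set" where
  "cofinite_homeos X \<H> =
     {u \<in> I_S X \<H> X \<H>. finite (topspace X - Domain u) \<and> finite (topspace X - Range u)}"

definition PC_rel ::
  "'x topology \<Rightarrow> ('x \<times> 'a) set set \<Rightarrow> (('x \<times> 'x) set \<times> ('x \<times> 'x) set) set" where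
  "PC_rel X \<H> = {(u, v). u \<in> cofinite_homeos X \<H> \<and> v \<in> cofinite_homeos X \<H> \<and>
     (\<exists>D \<subseteq> Domain u \<inter> Domain v. finite (topspace X - D) \<and> (\<forall>x\<in>D. u `` {x} = v `` {x}))}"

definition PC :: "'x topology \<Rightarrow> ('x \<times> 'a) set set \<Rightarrow> ('x \<times> 'x) set set monoid" where
  "PC X \<H> =
     \<lparr>carrier = cofinite_homeos X \<H> // PC_rel X \<H>,
      monoid.mult = (\<lambda>g h. \<Union>u\<in>g. \<Union>v\<in>h. PC_rel X \<H> `` {u \<circ>\<^sub>p v}),
      one = PC_rel X \<H> `` {Id_on (topspace X)}\<rparr>"

text \<open>An element of \<^term>\<open>carrier (PC X \<H>)\<close> is the set of all its representatives.\<close>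

definition alpha_S :: "('x \<times> 'x) set set \<Rightarrow> ('x \<times> 'x) set" where
  "alpha_S g = \<Union>g"

definition restrict_paction :: "('g \<Rightarrow> ('x \<times> 'x) set) \<Rightarrow> 'x set \<Rightarrow> 'g \<Rightarrow> ('x \<times> 'x) set" where
  "restrict_paction \<alpha> Y = (\<lambda>g. \<alpha> g \<inter> Y \<times> Y)"

definition quotient_topology :: "'x topology \<Rightarrow> ('x \<times> 'x) set \<Rightarrow> 'x set topology" where
  "quotient_topology T R =
     topology (\<lambda>U. U \<subseteq> topspace T // R \<and> openin T {x \<in> topspace T. R `` {x} \<in> U})"

lemma openin_quotient_topology:
  "openin (quotient_topology T R) U \<longleftrightarrow>
     U \<subseteq> topspace T // R \<and> openin T {x \<in> topspace T. R `` {x} \<in> U}"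
proof -
  let ?P = "\<lambda>U. U \<subseteq> topspace T // R \<and> openin T {x \<in> topspace T. R `` {x} \<in> U}"
  have "istopology ?P"
    unfolding istopology_def
  proof (intro conjI allI impI)
    fix U V assume U: "?P U" and V: "?P V"
    then show "U \<inter> V \<subseteq> topspace T // R" by blast
    have "{x \<in> topspace T. R `` {x} \<in> U \<inter> V} =
          {x \<in> topspace T. R `` {x} \<in> U} \<inter> {x \<in> topspace T. R `` {x} \<in> V}" by blast
    then show "openin T {x \<in> topspace T. R `` {x} \<in> U \<inter> V}"
      using U V by auto
  next
    fix F assume F: "\<forall>U\<in>F. ?P U"
    then show "\<Union>F \<subseteq> topspace T // R" by blast
    have "{x \<in> topspace T. R `` {x} \<in> \<Union>F} = (\<Union>U\<in>F. {x \<in> topspace T. R `` {x} \<in> U})" by blast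
    then show "openin T {x \<in> topspace T. R `` {x} \<in> \<Union>F}"
      using F by auto
  qed
  then show ?thesis
    by (simp add: quotient_topology_def topology_inverse')
qed

lemma topspace_quotient_topology [simp]: "topspace (quotient_topology T R) = topspace T // R"
proof (rule antisym)
  show "topspace (quotient_topology T R) \<subseteq> topspace T // R"
    using openin_quotient_topology openin_topspace by blast
  have "{x \<in> topspace T. R `` {x} \<in> topspace T // R} = topspace T"
    by (auto simp: quotient_def)
  then have "openin (quotient_topology T R) (topspace T // R)"
    by (simp add: openin_quotient_topology)
  then show "topspace T // R \<subseteq> topspace (quotient_topology T R)"
    by (rule openin_subset)
qed

lemma quotient_map_quotient_topology:
  "quotient_map T (quotient_topology T R) (\<lambda>x. R `` {x})"
  unfolding quotient_map_def
  by (auto simp: openin_quotient_topology quotient_def)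

definition glob_rel ::
  "('g, 'm) monoid_scheme \<Rightarrow> 'x topology \<Rightarrow> ('g \<Rightarrow> ('x \<times> 'x) set) \<Rightarrow> (('g \<times> 'x) \<times> ('g \<times> 'x)) set" where
  "glob_rel G X \<alpha> =
     {((h, x), (k, y)). h \<in> carrier G \<and> x \<in> topspace X \<and> k \<in> carrier G \<and> y \<in> topspace X \<and>
        (x, y) \<in> \<alpha> (inv\<^bsub>G\<^esub> k \<otimes>\<^bsub>G\<^esub> h)}"

definition glob ::
  "('g, 'm) monoid_scheme \<Rightarrow> 'x topology \<Rightarrow> ('g \<Rightarrow> ('x \<times> 'x) set) \<Rightarrow> ('g \<times> 'x) set topology" where
  "glob G X \<alpha> =
     quotient_topology (prod_topology (discrete_topology (carrier G)) X) (glob_rel G X \<alpha>)"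

text \<open>Restricted to the carrier, as required by \<^locale>\<open>group_action\<close>.\<close>

definition glob_act ::
  "('g, 'm) monoid_scheme \<Rightarrow> 'x topology \<Rightarrow> ('g \<Rightarrow> ('x \<times> 'x) set) \<Rightarrow>
     'g \<Rightarrow> ('g \<times> 'x) set \<Rightarrow> ('g \<times> 'x) set" where
  "glob_act G X \<alpha> g =
     (\<lambda>c \<in> topspace (glob G X \<alpha>). glob_rel G X \<alpha> `` ((\<lambda>(h, x). (g \<otimes>\<^bsub>G\<^esub> h, x)) ` c))"

definition glob_act_graph ::
  "('g, 'm) monoid_scheme \<Rightarrow> 'x topology \<Rightarrow> ('g \<Rightarrow> ('x \<times> 'x) set) \<Rightarrow>
     'g \<Rightarrow> (('g \<times> 'x) set \<times> ('g \<times> 'x) set) set" where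
  "glob_act_graph G X \<alpha> g = graph_on (topspace (glob G X \<alpha>)) (glob_act G X \<alpha> g)"

definition glob_embed ::
  "('g, 'm) monoid_scheme \<Rightarrow> 'x topology \<Rightarrow> ('g \<Rightarrow> ('x \<times> 'x) set) \<Rightarrow> 'x \<Rightarrow> ('g \<times> 'x) set" where
  "glob_embed G X \<alpha> x = glob_rel G X \<alpha> `` {(\<one>\<^bsub>G\<^esub>, x)}"

definition glob_embed_graph ::
  "('g, 'm) monoid_scheme \<Rightarrow> 'x topology \<Rightarrow> ('g \<Rightarrow> ('x \<times> 'x) set) \<Rightarrow> ('x \<times> ('g \<times> 'x) set) set" where
  "glob_embed_graph G X \<alpha> = graph_on (topspace X) (glob_embed G X \<alpha>)"

definition transfixed ::
  "('g, 'm) monoid_scheme \<Rightarrow> 'x topology \<Rightarrow> ('g \<Rightarrow> ('x \<times> 'x) set) \<Rightarrow> bool" where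
  "transfixed G X \<alpha> \<longleftrightarrow>
     (\<exists>X\<^sub>0 \<subseteq> topspace (glob G X \<alpha>).
        (\<forall>g\<in>carrier G. glob_act G X \<alpha> g ` X\<^sub>0 = X\<^sub>0) \<and>
        finite (sym_diff (glob_embed G X \<alpha> ` topspace X) X\<^sub>0))"

text \<open>
  \<open>\<K>\<close> is the \<open>G\<close>-invariant \<open>S\<close>-structure on the globalization that extends the structure \<open>\<H>\<close> of
  \<open>X\<close>: the charts of \<open>\<K>\<close> defined inside the copy of \<open>X\<close> are the charts of \<open>\<H>\<close>, transported by the
  embedding.
\<close>

definition glob_structure ::
  "'a topology \<Rightarrow> ('a \<times> 'a) set set \<Rightarrow> ('g, 'm) monoid_scheme \<Rightarrow> 'x topology \<Rightarrow>
     ('x \<times> 'a) set set \<Rightarrow> ('g \<Rightarrow> ('x \<times> 'x) set) \<Rightarrow> (('g \<times> 'x) set \<times> 'a) set set \<Rightarrow> bool" where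
  "glob_structure A S G X \<H> \<alpha> \<K> \<longleftrightarrow>
     S_structure A S (glob G X \<alpha>) \<K> \<and>
     (\<forall>g\<in>carrier G. \<forall>f\<in>\<K>. f \<circ>\<^sub>p glob_act_graph G X \<alpha> g \<in> \<K>) \<and>
     restrict_structure \<K> (glob_embed G X \<alpha> ` topspace X) =
       (\<lambda>f. f \<circ>\<^sub>p (glob_embed_graph G X \<alpha>)\<inverse>) ` \<H>"

end

theory Submission
  imports Defs
begin

text \<open>
  Two points of the globalization that some \<open>g\<close> moves into the copy of the Hausdorff space \<open>X\<close> are
  separated there, hence were separated before. Let \<open>X\<^sub>0\<close> be the invariant set that is commensurate
  to \<open>X\<close>, let \<open>F = X\<^sub>0 - X\<close>, which is finite, and remove from \<open>X\<^sub>0\<close> the finite orbits that meet \<open>F\<close>.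
  What remains is invariant, and a point of it whose orbit meets \<open>F\<close> has an infinite orbit; by
  B. H. Neumann's lemma any two of its points are therefore moved simultaneously outside \<open>F\<close>, that
  is, into \<open>X\<close>. So \<open>Y\<close>, the part of \<open>X\<close> that remains, has a Hausdorff globalization, of which it
  misses only points of \<open>F\<close>. The charts of the globalization are the partial homeomorphisms whose
  pullbacks along all translates of the embedding of \<open>Y\<close> are charts.
\<close>

text \<open>Being Hausdorff is a condition on pairs of points, so it suffices that any two points
  lie in one common translate of the copy of \<open>Y\<close>, which is open and homeomorphic to
  \<open>Y\<close>. Only the points of \<open>F\<close> prevent landing in that copy. Two points
  with finite orbits meeting \<open>F\<close> may never leave \<open>F\<close> together (two points
  swapped by a group of order two, one of them in \<open>F\<close>). Such orbits are therefore
  deleted whole: this keeps invariance, and since each contains a point of \<open>F\<close> there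
  are only finitely many of them, so finitely many points are lost. An orbit that misses
  \<open>F\<close> does no harm, whatever its size.

  A second obstacle is that elements of \<open>PC X \<H>\<close> are classes modulo finite sets,
  whereas a partial action needs actual values. In a Hausdorff space without isolated points, two
  representatives that agree up to finitely many points agree wherever both are defined. This
  rigidity makes the union of all representatives of a class a partial bijection.\<close>

section \<open>Partial homeomorphisms\<close>

text \<open>With images and preimages of open sets as the only topological data, converse,
  composition and union become computations with relations, and no underlying function has to be
  carried along. Continuity is the preimage half, openness the image half.\<close>

lemma I_top_iff:
  "u \<in> I_top A B \<longleftrightarrow>
     u \<subseteq> topspace A \<times> topspace B \<and> single_valued u \<and> single_valued (u\<inverse>) \<and>
     (\<forall>U. openin A U \<longrightarrow> openin B (u `` U)) \<and> (\<forall>V. openin B V \<longrightarrow> openin A (u\<inverse> `` V))"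
  (is "?L \<longleftrightarrow> ?R")
proof
  assume ?L
  then obtain U V f where U: "openin A U" and V: "openin B V"
    and hom: "homeomorphic_map (subtopology A U) (subtopology B V) f" and u: "u = graph_on U f"
    unfolding I_top_def by blast
  have tU: "topspace (subtopology A U) = U" "topspace (subtopology B V) = V"
    using openin_subset[OF U] openin_subset[OF V] by auto
  have inj: "inj_on f U" and im: "f ` U = V"
    using homeomorphic_imp_injective_map[OF hom] homeomorphic_imp_surjective_map[OF hom] tU by auto
  have "openin B (u `` W)" if "openin A W" for W
  proof -
    have "openin (subtopology A U) (W \<inter> U)"
      using that by (auto simp: openin_subtopology)
    then have "openin (subtopology B V) (f ` (W \<inter> U))"
      using homeomorphic_imp_open_map[OF hom] by (simp add: open_map_def)
    moreover have "f ` (W \<inter> U) = u `` W"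
      by (auto simp: u graph_on_def)
    ultimately show ?thesis
      using V openin_trans_full by metis
  qed
  moreover have "openin A (u\<inverse> `` W)" if "openin B W" for W
  proof -
    have "openin (subtopology B V) (W \<inter> V)"
      using that by (auto simp: openin_subtopology)
    then have "openin (subtopology A U) {x \<in> U. f x \<in> W \<inter> V}"
      using openin_continuous_map_preimage[OF homeomorphic_imp_continuous_map[OF hom]] tU by metis
    moreover have "{x \<in> U. f x \<in> W \<inter> V} = u\<inverse> `` W"
      using im by (auto simp: u graph_on_def)
    ultimately show ?thesis
      using U openin_trans_full by metis
  qed
  moreover have "u \<subseteq> topspace A \<times> topspace B" "single_valued u" "single_valued (u\<inverse>)"
    using openin_subset[OF U] openin_subset[OF V] im inj
    by (auto simp: u graph_on_def single_valued_def inj_on_def)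
  ultimately show ?R by blast
next
  assume R: ?R
  \<comment> \<open>Outside \<open>Domain u\<close> the value of \<open>f\<close> is arbitrary; the
    graph is taken over \<open>Domain u\<close> only.\<close>
  define f where "f = (\<lambda>x. THE y. (x, y) \<in> u)"
  have f: "f x = y" if "(x, y) \<in> u" for x y
    unfolding f_def using R that by (auto dest: single_valuedD)
  have D: "openin A (Domain u)"
  proof -
    have "Domain u = u\<inverse> `` topspace B" using R by blast
    then show ?thesis using R by simp
  qed
  have Ra: "openin B (Range u)"
  proof -
    have "Range u = u `` topspace A" using R by blast
    then show ?thesis using R by simp
  qed
  have tD: "topspace (subtopology A (Domain u)) = Domain u" "topspace (subtopology B (Range u)) = Range u"
    using openin_subset[OF D] openin_subset[OF Ra] by auto
  have "homeomorphic_map (subtopology A (Domain u)) (subtopology B (Range u)) f"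
  proof (rule bijective_open_imp_homeomorphic_map)
    show "continuous_map (subtopology A (Domain u)) (subtopology B (Range u)) f"
      unfolding continuous_map_def tD
    proof (intro conjI allI impI)
      show "f \<in> Domain u \<rightarrow> Range u" using f by auto
      fix W assume "openin (subtopology B (Range u)) W"
      then have "openin B W" "W \<subseteq> Range u"
        using Ra openin_trans_full openin_subset tD by metis+
      moreover have "{x \<in> Domain u. f x \<in> W} = u\<inverse> `` W"
        using f by blast
      ultimately show "openin (subtopology A (Domain u)) {x \<in> Domain u. f x \<in> W}"
        using R D by (auto simp: openin_open_subtopology)
    qed
    show "open_map (subtopology A (Domain u)) (subtopology B (Range u)) f"
      unfolding open_map_def
    proof (intro allI impI)
      fix W assume "openin (subtopology A (Domain u)) W"
      then have "openin A W" "W \<subseteq> Domain u"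
        using D openin_trans_full openin_subset tD by metis+
      moreover from this have "f ` W = u `` W"
        using f by blast
      ultimately show "openin (subtopology B (Range u)) (f ` W)"
        using R Ra by (auto simp: openin_open_subtopology)
    qed
    show "f ` topspace (subtopology A (Domain u)) = topspace (subtopology B (Range u))"
      unfolding tD using f by force
    show "inj_on f (topspace (subtopology A (Domain u)))"
      unfolding tD inj_on_def using f R by (auto simp: single_valued_def)
  qed
  moreover have "u = graph_on (Domain u) f"
    using f by (auto simp: graph_on_def)
  ultimately show ?L
    unfolding I_top_def using D Ra by blast
qed

lemma I_top_subset: "u \<in> I_top A B \<Longrightarrow> u \<subseteq> topspace A \<times> topspace B"
  by (simp add: I_top_iff)

lemma I_top_converse: "u \<in> I_top A B \<Longrightarrow> u\<inverse> \<in> I_top B A"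
  by (auto simp: I_top_iff)

lemma I_top_comp: "u \<in> I_top A B \<Longrightarrow> v \<in> I_top B C \<Longrightarrow> u O v \<in> I_top A C"
  unfolding I_top_iff
  by (simp add: relcomp_Image converse_relcomp single_valued_relcomp) blast

text \<open>Images commute with unions, so openness is inherited from the pieces; what gluing can
  destroy is that the relation and its converse are single-valued.\<close>

lemma I_top_Union:
  assumes "\<And>u. u \<in> F \<Longrightarrow> u \<in> I_top A B" "single_valued (\<Union>F)" "single_valued ((\<Union>F)\<inverse>)"
  shows "\<Union>F \<in> I_top A B"
proof -
  have "(\<Union>F) `` U = (\<Union>u\<in>F. u `` U)" "(\<Union>F)\<inverse> `` V = (\<Union>u\<in>F. u\<inverse> `` V)" for U V
    by blast+
  moreover have "\<Union>F \<subseteq> topspace A \<times> topspace B"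
    using I_top_subset[OF assms(1)] by (rule Union_least)
  ultimately show ?thesis
    using assms unfolding I_top_iff by auto
qed

lemma Id_on_I_top: "openin A U \<Longrightarrow> Id_on U \<in> I_top A A"
proof -
  assume U: "openin A U"
  have "Id_on U `` V = U \<inter> V" for V by blast
  then show ?thesis
    using U openin_subset[OF U] by (auto simp: I_top_iff single_valued_def)
qed

lemma I_top_restrict:
  assumes "u \<in> I_top A B" "openin A U" "openin B V"
  shows "u \<inter> U \<times> V \<in> I_top A B"
proof -
  have "u \<inter> U \<times> V = (Id_on U O u) O Id_on V" by blast
  then show ?thesis
    using assms by (auto intro!: I_top_comp Id_on_I_top)
qed

lemma I_top_subtopology:
  assumes "openin A U" "openin B V"
  shows "u \<in> I_top (subtopology A U) (subtopology B V) \<longleftrightarrow> u \<in> I_top A B \<and> u \<subseteq> U \<times> V"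
proof
  have sub: "U \<subseteq> topspace A" "V \<subseteq> topspace B"
    using assms openin_subset by blast+
  {
    assume u: "u \<in> I_top (subtopology A U) (subtopology B V)"
    then have uUV: "u \<subseteq> U \<times> V" by (fastforce dest: I_top_subset)
    then have W: "u `` W = u `` (W \<inter> U)" "u\<inverse> `` W' = u\<inverse> `` (W' \<inter> V)" for W W' by blast+
    have "openin B (u `` W)" if "openin A W" for W
      using u that assms unfolding W(1)[of W] I_top_iff by (auto simp: openin_open_subtopology)
    moreover have "openin A (u\<inverse> `` W)" if "openin B W" for W
      using u that assms unfolding W(2)[of W] I_top_iff by (auto simp: openin_open_subtopology)
    moreover have "single_valued u" "single_valued (u\<inverse>)"
      using u by (simp_all add: I_top_iff)
    ultimately show "u \<in> I_top A B \<and> u \<subseteq> U \<times> V"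
      using uUV sub by (auto simp: I_top_iff)
  }
  {
    assume "u \<in> I_top A B \<and> u \<subseteq> U \<times> V"
    then show "u \<in> I_top (subtopology A U) (subtopology B V)"
      using assms sub unfolding I_top_iff by (auto simp: openin_open_subtopology)
  }
qed

section \<open>Structure-preserving partial homeomorphisms\<close>

lemma S_hatI: "u \<in> I_top A A \<Longrightarrow> F \<subseteq> S \<Longrightarrow> u = \<Union>F \<Longrightarrow> u \<in> S_hat A S"
  unfolding S_hat_def by blast

text \<open>The basis axiom puts only the identities of basic open sets into \<open>S\<close>; other
  open sets are reached by unions, hence \<open>S_hat\<close> instead of \<open>S\<close>.\<close>

lemma Id_on_S_hat:
  assumes "pseudogroup A S" "openin A V"
  shows "Id_on V \<in> S_hat A S"
proof -
  obtain \<U> where "\<And>U. U \<in> \<U> \<Longrightarrow> Id_on U \<in> S" "V = \<Union>\<U>"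
    using assms unfolding pseudogroup_def union_of_def by auto
  then have "Id_on ` \<U> \<subseteq> S" "Id_on V = \<Union>(Id_on ` \<U>)" by auto
  then show ?thesis
    by (intro S_hatI[OF Id_on_I_top[OF assms(2)]])
qed

lemma S_structure_I_top: "S_structure A S X \<H> \<Longrightarrow> f \<in> \<H> \<Longrightarrow> f \<in> I_top X A"
  unfolding S_structure_def S_atlas_def by auto

lemma
  assumes "S_structure A S X \<H>"
  shows S_structure_empty: "{} \<in> \<H>"
    and S_structure_cover: "\<Union>(Domain ` \<H>) = topspace X"
    and S_structure_transition: "f \<in> \<H> \<Longrightarrow> g \<in> \<H> \<Longrightarrow> f\<inverse> O g \<in> S_hat A S"
    and S_structure_comp: "f \<in> \<H> \<Longrightarrow> u \<in> S \<Longrightarrow> f O u \<in> \<H>"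
    and S_structure_Union: "F \<subseteq> \<H> \<Longrightarrow> \<Union>F \<in> I_top X A \<Longrightarrow> \<Union>F \<in> \<H>"
  using assms by (simp_all add: S_structure_def S_atlas_def)

lemma S_structure_chartE:
  assumes "S_structure A S X \<H>" "x \<in> topspace X"
  obtains f a where "f \<in> \<H>" "(x, a) \<in> f"
proof -
  have "x \<in> \<Union>(Domain ` \<H>)" using assms S_structure_cover by metis
  then show thesis using that by auto
qed

text \<open>Completeness under unions upgrades stability under \<open>S\<close> to stability under
  \<open>S_hat\<close>, where transition maps and identities of open sets live.\<close>

lemma S_structure_comp_S_hat:
  assumes "S_structure A S X \<H>" "f \<in> \<H>" "s \<in> S_hat A S"
  shows "f O s \<in> \<H>"
proof -
  obtain F where "F \<subseteq> S" and s: "s = \<Union>F" "s \<in> I_top A A"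
    using assms(3) unfolding S_hat_def by blast
  then have "(\<lambda>u. f O u) ` F \<subseteq> \<H>"
    using assms(1,2) by (auto intro: S_structure_comp)
  moreover have "f O s = \<Union>((\<lambda>u. f O u) ` F)"
    using s by blast
  moreover have "f O s \<in> I_top X A"
    using s assms S_structure_I_top I_top_comp by metis
  ultimately show ?thesis
    using S_structure_Union[OF assms(1)] by metis
qed

text \<open>A chart is injective, so cutting its domain down to \<open>U\<close> is the same as
  cutting its range down to the image of \<open>U\<close>, and the latter is composition with an
  identity in \<open>S_hat\<close>.\<close>

lemma S_structure_restrict:
  assumes "pseudogroup A S" "S_structure A S X \<H>" "f \<in> \<H>" "openin X U"
  shows "Id_on U O f \<in> \<H>"
proof -
  have f: "f \<in> I_top X A"
    using assms S_structure_I_top by metis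
  then have "f O Id_on (f `` U) \<in> \<H>"
    using assms by (intro S_structure_comp_S_hat Id_on_S_hat) (auto simp: I_top_iff)
  moreover have "f O Id_on (f `` U) = Id_on U O f"
  proof -
    have "single_valued (f\<inverse>)" using f by (simp add: I_top_iff)
    then have "x = y" if "(x, a) \<in> f" "(y, a) \<in> f" for x y a
      using that by (auto dest: single_valuedD)
    then show ?thesis by blast
  qed
  ultimately show ?thesis by simp
qed

lemma I_S_I_top: "u \<in> I_S X \<H> Y \<K> \<Longrightarrow> u \<in> I_top X Y"
  by (simp add: I_S_def)

lemma I_SI:
  "u \<in> I_top X Y \<Longrightarrow> F \<subseteq> {a O b\<inverse> | a b. a \<in> \<H> \<and> b \<in> \<K>} \<Longrightarrow> u = \<Union>F \<Longrightarrow> u \<in> I_S X \<H> Y \<K>"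
  by (auto simp: I_S_def)

lemma I_SE:
  assumes "u \<in> I_S X \<H> Y \<K>"
  obtains F where "u \<in> I_top X Y" "F \<subseteq> {a O b\<inverse> | a b. a \<in> \<H> \<and> b \<in> \<K>}" "u = \<Union>F"
  using assms by (auto simp: I_S_def)

text \<open>On a piece \<open>a O b\<inverse>\<close> of \<open>u\<close>, the pullback of
  \<open>f\<close> is \<open>a\<close> followed by the transition map
  \<open>b\<inverse> O f\<close>, which lies in \<open>S_hat\<close>. Completeness then reassembles
  the pieces.\<close>

lemma I_S_pullback:
  assumes X: "S_structure A S X \<H>" and Y: "S_structure A S Y \<K>"
    and u: "u \<in> I_S X \<H> Y \<K>" and f: "f \<in> \<K>"
  shows "u O f \<in> \<H>"
proof -
  obtain F where F: "F \<subseteq> {a O b\<inverse> | a b. a \<in> \<H> \<and> b \<in> \<K>}" and uF: "u = \<Union>F" and ut: "u \<in> I_top X Y"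
    using u by (rule I_SE)
  have "p O f \<in> \<H>" if "p \<in> F" for p
  proof -
    obtain a b where ab: "p = a O b\<inverse>" "a \<in> \<H>" "b \<in> \<K>"
      using F \<open>p \<in> F\<close> by blast
    moreover from this have "b\<inverse> O f \<in> S_hat A S"
      using Y f by (intro S_structure_transition)
    ultimately show ?thesis
      using S_structure_comp_S_hat[OF X] by (simp add: O_assoc)
  qed
  then have "(\<lambda>p. p O f) ` F \<subseteq> \<H>" by blast
  moreover have "u O f = \<Union>((\<lambda>p. p O f) ` F)" using uF by blast
  moreover have "u O f \<in> I_top X A"
    using ut S_structure_I_top[OF Y f] by (rule I_top_comp)
  ultimately show ?thesis
    using S_structure_Union[OF X] by metis
qed

text \<open>The definition by pieces is symmetric in the two spaces and suits converses; this
  criterion by pullbacks suits composition and unions. The pullbacks determine \<open>u\<close>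
  because the chart domains cover \<open>Y\<close>.\<close>

lemma I_S_iff:
  assumes X: "S_structure A S X \<H>" and Y: "S_structure A S Y \<K>"
  shows "u \<in> I_S X \<H> Y \<K> \<longleftrightarrow> u \<in> I_top X Y \<and> (\<forall>f\<in>\<K>. u O f \<in> \<H>)"
proof (intro iffI conjI ballI)
  show "u \<in> I_top X Y" if "u \<in> I_S X \<H> Y \<K>"
    using that by (rule I_S_I_top)
  show "u O f \<in> \<H>" if "u \<in> I_S X \<H> Y \<K>" "f \<in> \<K>" for f
    using I_S_pullback[OF X Y] that .
  assume u: "u \<in> I_top X Y \<and> (\<forall>f\<in>\<K>. u O f \<in> \<H>)"
  have "\<Union>((\<lambda>f. (u O f) O f\<inverse>) ` \<K>) = u"
  proof
    show "\<Union>((\<lambda>f. (u O f) O f\<inverse>) ` \<K>) \<subseteq> u"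
    proof clarify
      fix x y a y' f assume "f \<in> \<K>" "(x, y) \<in> u" "(y, a) \<in> f" "(y', a) \<in> f"
      moreover from this have "single_valued (f\<inverse>)"
        using S_structure_I_top[OF Y] by (simp add: I_top_iff)
      ultimately show "(x, y') \<in> u" by (auto dest: single_valuedD)
    qed
    show "u \<subseteq> \<Union>((\<lambda>f. (u O f) O f\<inverse>) ` \<K>)"
    proof clarify
      fix x y assume xy: "(x, y) \<in> u"
      then have "y \<in> topspace Y" using u by (auto dest!: I_top_subset)
      then obtain f a where "f \<in> \<K>" "(y, a) \<in> f" by (rule S_structure_chartE[OF Y])
      with xy show "(x, y) \<in> \<Union>((\<lambda>f. (u O f) O f\<inverse>) ` \<K>)" by auto
    qed
  qed
  moreover have "(\<lambda>f. (u O f) O f\<inverse>) ` \<K> \<subseteq> {f O g\<inverse> | f g. f \<in> \<H> \<and> g \<in> \<K>}"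
    using u by blast
  ultimately show "u \<in> I_S X \<H> Y \<K>"
    using u by (intro I_SI) auto
qed

lemma I_S_comp:
  assumes "S_structure A S X \<H>" "S_structure A S Y \<K>" "S_structure A S Z \<L>"
    and "u \<in> I_S X \<H> Y \<K>" "v \<in> I_S Y \<K> Z \<L>"
  shows "u O v \<in> I_S X \<H> Z \<L>"
  using assms by (auto simp: I_S_iff O_assoc intro: I_top_comp)

lemma I_S_converse:
  assumes "u \<in> I_S X \<H> Y \<K>"
  shows "u\<inverse> \<in> I_S Y \<K> X \<H>"
proof -
  obtain F where F: "F \<subseteq> {a O b\<inverse> | a b. a \<in> \<H> \<and> b \<in> \<K>}" "u = \<Union>F"
    using assms by (rule I_SE)
  then have "u\<inverse> = \<Union>(converse ` F)" by blast
  moreover have "converse ` F \<subseteq> {b O a\<inverse> | b a. b \<in> \<K> \<and> a \<in> \<H>}"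
    using F(1) by (force simp: converse_relcomp)
  ultimately show ?thesis
    using assms by (intro I_SI[of _ _ _ "converse ` F"] I_top_converse I_S_I_top)
qed

lemma I_S_Id:
  assumes "S_structure A S X \<H>"
  shows "Id_on (topspace X) \<in> I_S X \<H> X \<H>"
proof -
  have "Id_on (topspace X) O f = f" if "f \<in> \<H>" for f
    using I_top_subset[OF S_structure_I_top[OF assms that]] by blast
  then show ?thesis
    using assms by (auto simp: I_S_iff intro: Id_on_I_top)
qed

lemma I_S_Union:
  assumes X: "S_structure A S X \<H>" and Y: "S_structure A S Y \<K>"
    and F: "\<And>u. u \<in> F \<Longrightarrow> u \<in> I_S X \<H> Y \<K>"
    and sv: "single_valued (\<Union>F)" "single_valued ((\<Union>F)\<inverse>)"
  shows "\<Union>F \<in> I_S X \<H> Y \<K>"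
  unfolding I_S_iff[OF X Y]
proof (intro conjI ballI)
  show UF: "\<Union>F \<in> I_top X Y"
    using F sv by (intro I_top_Union I_S_I_top)
  fix f assume f: "f \<in> \<K>"
  have "\<Union>F O f = \<Union>((\<lambda>u. u O f) ` F)" by blast
  moreover have "(\<lambda>u. u O f) ` F \<subseteq> \<H>"
    using I_S_pullback[OF X Y F f] by blast
  moreover have "\<Union>F O f \<in> I_top X A"
    using UF S_structure_I_top[OF Y f] by (rule I_top_comp)
  ultimately show "\<Union>F O f \<in> \<H>"
    using S_structure_Union[OF X] by metis
qed

lemma S_structure_restrict_structure:
  assumes "pseudogroup A S" and X: "S_structure A S X \<H>" and Y: "openin X Y"
  shows "S_structure A S (subtopology X Y) (restrict_structure \<H> Y)"
proof -
  have YX: "Y \<subseteq> topspace X" using Y by (rule openin_subset)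
  have top: "f \<in> I_top (subtopology X Y) A \<longleftrightarrow> f \<in> I_top X A \<and> Domain f \<subseteq> Y" for f
    using I_top_subtopology[OF Y openin_topspace[of A], of f] I_top_subset[of f X A] by auto
  have "Y \<subseteq> \<Union>(Domain ` restrict_structure \<H> Y)"
  proof
    fix x assume x: "x \<in> Y"
    then obtain f where f: "f \<in> \<H>" "x \<in> Domain f"
      using S_structure_chartE[OF X] YX by (metis Domain.DomainI subsetD)
    \<comment> \<open>Openness of \<open>Y\<close> matters here: any chart around \<open>x\<close>,
      cut down to \<open>Y\<close>, is still a chart.\<close>
    then have "Id_on Y O f \<in> restrict_structure \<H> Y"
      using assms S_structure_restrict by (auto simp: restrict_structure_def)
    moreover have "x \<in> Domain (Id_on Y O f)" using f x by auto
    ultimately show "x \<in> \<Union>(Domain ` restrict_structure \<H> Y)" by blast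
  qed
  then have cover: "\<Union>(Domain ` restrict_structure \<H> Y) = topspace (subtopology X Y)"
    using YX by (auto simp: restrict_structure_def)
  have "{} \<in> \<H>"
    and trans: "\<And>f g. f \<in> \<H> \<Longrightarrow> g \<in> \<H> \<Longrightarrow> f\<inverse> O g \<in> S_hat A S"
    and comp: "\<And>f u. f \<in> \<H> \<Longrightarrow> u \<in> S \<Longrightarrow> f O u \<in> \<H>"
    and Un: "\<And>F. F \<subseteq> \<H> \<Longrightarrow> \<Union>F \<in> I_top X A \<Longrightarrow> \<Union>F \<in> \<H>"
    using X by (auto intro: S_structure_empty S_structure_transition S_structure_comp S_structure_Union)
  then show ?thesis
    unfolding S_structure_def S_atlas_def cover
    using S_structure_I_top[OF X]
    by (intro conjI ballI allI impI subsetI) (auto simp: top restrict_structure_def intro!: Un)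
qed

lemma I_S_restrict:
  assumes "pseudogroup A S" and X: "S_structure A S X \<H>" and Y: "openin X Y"
    and u: "u \<in> I_S X \<H> X \<H>"
  shows "u \<inter> Y \<times> Y \<in>
    I_S (subtopology X Y) (restrict_structure \<H> Y) (subtopology X Y) (restrict_structure \<H> Y)"
proof -
  have "u \<in> I_top X X" using u by (rule I_S_I_top)
  then have "u \<inter> Y \<times> Y \<in> I_top (subtopology X Y) (subtopology X Y)"
    using Y by (simp add: I_top_subtopology I_top_restrict)
  moreover have "(u \<inter> Y \<times> Y) O f \<in> restrict_structure \<H> Y" if "f \<in> restrict_structure \<H> Y" for f
  proof -
    have f: "f \<in> \<H>" "Domain f \<subseteq> Y" using that by (auto simp: restrict_structure_def)
    \<comment> \<open>Since \<open>f\<close> is defined only inside \<open>Y\<close>, the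
      restriction in the target is automatic and only the one in the source remains.\<close>
    then have "(u \<inter> Y \<times> Y) O f = Id_on Y O (u O f)" by blast
    moreover have "Id_on Y O (u O f) \<in> \<H>"
      using assms f I_S_pullback by (blast intro: S_structure_restrict)
    ultimately show ?thesis by (auto simp: restrict_structure_def)
  qed
  ultimately show ?thesis
    using S_structure_restrict_structure[OF assms(1-3)] by (simp add: I_S_iff)
qed

section \<open>The universal globalization of a partial action\<close>

lemma (in group)
  assumes "k \<in> carrier G" "h \<in> carrier G"
  shows mult_inv_cancel: "k \<otimes> (inv k \<otimes> h) = h"
    and inv_mult_cancel: "inv k \<otimes> (k \<otimes> h) = h"
  using assms by (simp_all add: m_assoc[symmetric])

locale partial_action = group G for G :: "('g, 'm) monoid_scheme" (structure) +
  fixes X :: "'x topology" and \<alpha> :: "'g \<Rightarrow> ('x \<times> 'x) set"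
  assumes I_top: "g \<in> carrier G \<Longrightarrow> \<alpha> g \<in> I_top X X"
    and one: "\<alpha> \<one> = Id_on (topspace X)"
    and inverse: "g \<in> carrier G \<Longrightarrow> \<alpha> (inv g) = (\<alpha> g)\<inverse>"
    and mult: "g \<in> carrier G \<Longrightarrow> h \<in> carrier G \<Longrightarrow> \<alpha> h O \<alpha> g \<subseteq> \<alpha> (g \<otimes> h)"
begin

abbreviation proj :: "'g \<Rightarrow> 'x \<Rightarrow> ('g \<times> 'x) set" where
  "proj h x \<equiv> glob_rel G X \<alpha> `` {(h, x)}"

text \<open>The embedding of \<open>X\<close> as the translate \<open>h \<cdot> X\<close> of its copy in the globalization.\<close>

definition embed_at :: "'g \<Rightarrow> ('x \<times> ('g \<times> 'x) set) set" where
  "embed_at h = graph_on (topspace X) (proj h)"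

lemma topspace_eq: "(x, y) \<in> \<alpha> g \<Longrightarrow> g \<in> carrier G \<Longrightarrow> x \<in> topspace X \<and> y \<in> topspace X"
  using I_top_subset[OF I_top] by blast

text \<open>The axioms \<open>one\<close>, \<open>inverse\<close> and \<open>mult\<close> give
  reflexivity, symmetry and transitivity respectively; for the last, the middle factors of
  \<open>(inv l \<otimes> k) \<otimes> (inv k \<otimes> h)\<close> cancel.\<close>

lemma equiv_glob_rel: "equiv (carrier G \<times> topspace X) (glob_rel G X \<alpha>)"
proof (rule equivI)
  show "glob_rel G X \<alpha> \<subseteq> (carrier G \<times> topspace X) \<times> (carrier G \<times> topspace X)"
    by (auto simp: glob_rel_def)
  show "refl_on (carrier G \<times> topspace X) (glob_rel G X \<alpha>)"
    by (auto simp: refl_on_def glob_rel_def one)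
  show "sym (glob_rel G X \<alpha>)"
  proof (rule symI)
    fix p q assume "(p, q) \<in> glob_rel G X \<alpha>"
    then obtain h x k y where pq: "p = (h, x)" "q = (k, y)" and
      c: "h \<in> carrier G" "k \<in> carrier G" "x \<in> topspace X" "y \<in> topspace X"
      and a: "(x, y) \<in> \<alpha> (inv k \<otimes> h)"
      by (auto simp: glob_rel_def)
    have "inv (inv k \<otimes> h) = inv h \<otimes> k"
      using c by (simp add: inv_mult_group)
    then have "\<alpha> (inv h \<otimes> k) = (\<alpha> (inv k \<otimes> h))\<inverse>"
      using inverse[of "inv k \<otimes> h"] c by simp
    then show "(q, p) \<in> glob_rel G X \<alpha>"
      using pq c a by (auto simp: glob_rel_def)
  qed
  show "trans (glob_rel G X \<alpha>)"
  proof (rule transI)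
    fix p q r assume "(p, q) \<in> glob_rel G X \<alpha>" "(q, r) \<in> glob_rel G X \<alpha>"
    then obtain h x k y l z where pqr: "p = (h, x)" "q = (k, y)" "r = (l, z)" and
      c: "h \<in> carrier G" "k \<in> carrier G" "l \<in> carrier G" "x \<in> topspace X" "z \<in> topspace X"
      and a: "(x, y) \<in> \<alpha> (inv k \<otimes> h)" "(y, z) \<in> \<alpha> (inv l \<otimes> k)"
      by (auto simp: glob_rel_def)
    have "(inv l \<otimes> k) \<otimes> (inv k \<otimes> h) = inv l \<otimes> h"
      using c by (simp add: m_assoc mult_inv_cancel inv_mult_cancel)
    moreover have "(x, z) \<in> \<alpha> ((inv l \<otimes> k) \<otimes> (inv k \<otimes> h))"
      using a mult[of "inv l \<otimes> k" "inv k \<otimes> h"] c by blast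
    ultimately show "(p, r) \<in> glob_rel G X \<alpha>"
      using pqr c by (auto simp: glob_rel_def)
  qed
qed

lemma topspace_glob: "topspace (glob G X \<alpha>) = (carrier G \<times> topspace X) // glob_rel G X \<alpha>"
  by (simp add: glob_def)

lemma proj_in_glob [simp]: "h \<in> carrier G \<Longrightarrow> x \<in> topspace X \<Longrightarrow> proj h x \<in> topspace (glob G X \<alpha>)"
  by (auto simp: topspace_glob intro: quotientI)

lemma globE:
  assumes "c \<in> topspace (glob G X \<alpha>)"
  obtains h x where "h \<in> carrier G" "x \<in> topspace X" "c = proj h x"
  using assms by (auto simp: topspace_glob elim!: quotientE)

lemma proj_eq_iff:
  assumes "h \<in> carrier G" "x \<in> topspace X" "k \<in> carrier G" "y \<in> topspace X"
  shows "proj h x = proj k y \<longleftrightarrow> (x, y) \<in> \<alpha> (inv k \<otimes> h)"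
proof -
  have "proj h x = proj k y \<longleftrightarrow> ((h, x), (k, y)) \<in> glob_rel G X \<alpha>"
    using eq_equiv_class_iff[OF equiv_glob_rel, of "(h, x)" "(k, y)"] assms by simp
  then show ?thesis using assms by (simp add: glob_rel_def)
qed

lemma proj_one_eq_iff:
  "h \<in> carrier G \<Longrightarrow> x \<in> topspace X \<Longrightarrow> y \<in> topspace X \<Longrightarrow> proj h x = proj \<one> y \<longleftrightarrow> (x, y) \<in> \<alpha> h"
  by (simp add: proj_eq_iff)

text \<open>The group is discrete, so the product is the disjoint union of its slices, and openness
  in the quotient can be tested on each slice separately.\<close>

lemma openin_glob_iff:
  "openin (glob G X \<alpha>) V \<longleftrightarrow>
     V \<subseteq> topspace (glob G X \<alpha>) \<and> (\<forall>h\<in>carrier G. openin X {x \<in> topspace X. proj h x \<in> V})"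
proof -
  let ?T = "prod_topology (discrete_topology (carrier G)) X"
  let ?W = "{p \<in> topspace ?T. glob_rel G X \<alpha> `` {p} \<in> V}"
  have "openin ?T ?W \<longleftrightarrow> (\<forall>h\<in>carrier G. openin X {x \<in> topspace X. proj h x \<in> V})"
  proof
    assume W: "openin ?T ?W"
    show "\<forall>h\<in>carrier G. openin X {x \<in> topspace X. proj h x \<in> V}"
    proof
      fix h assume h: "h \<in> carrier G"
      then have "continuous_map X ?T (\<lambda>x. (h, x))"
        by (simp add: continuous_map_pairedI)
      then have "openin X {x \<in> topspace X. (h, x) \<in> ?W}"
        using W by (rule openin_continuous_map_preimage)
      moreover have "{x \<in> topspace X. (h, x) \<in> ?W} = {x \<in> topspace X. proj h x \<in> V}"
        using h by auto
      ultimately show "openin X {x \<in> topspace X. proj h x \<in> V}" by simp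
    qed
  next
    assume "\<forall>h\<in>carrier G. openin X {x \<in> topspace X. proj h x \<in> V}"
    then have "openin ?T ({h} \<times> {x \<in> topspace X. proj h x \<in> V})" if "h \<in> carrier G" for h
      using that by (simp add: openin_prod_Times_iff)
    then have "openin ?T (\<Union>h\<in>carrier G. {h} \<times> {x \<in> topspace X. proj h x \<in> V})"
      by (intro openin_Union) auto
    moreover have "(\<Union>h\<in>carrier G. {h} \<times> {x \<in> topspace X. proj h x \<in> V}) = ?W"
      by auto
    ultimately show "openin ?T ?W" by simp
  qed
  then show ?thesis
    by (simp add: glob_def openin_quotient_topology)
qed

section \<open>The translates of the copy of \<open>X\<close> as an open cover of the
  globalization\<close>

lemma embed_at_iff: "(x, c) \<in> embed_at h \<longleftrightarrow> x \<in> topspace X \<and> c = proj h x"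
  by (auto simp: embed_at_def graph_on_def)

lemma embed_at_vimage: "(embed_at h)\<inverse> `` V = {x \<in> topspace X. proj h x \<in> V}"
  unfolding Image_iff Bex_def converse_iff embed_at_iff Image_def by blast

lemma glob_embed_graph_eq: "glob_embed_graph G X \<alpha> = embed_at \<one>"
  by (simp add: glob_embed_graph_def glob_embed_def[abs_def] embed_at_def)

text \<open>The partial action consists of the transition maps between translates. Openness of the
  embeddings and compatibility of the transported charts both reduce to this identity.\<close>

lemma embed_at_comp_converse:
  assumes "h \<in> carrier G" "k \<in> carrier G"
  shows "embed_at h O (embed_at k)\<inverse> = \<alpha> (inv k \<otimes> h)"
proof -
  have "(x, y) \<in> embed_at h O (embed_at k)\<inverse> \<longleftrightarrow>
      x \<in> topspace X \<and> y \<in> topspace X \<and> proj h x = proj k y" for x y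
    by (auto simp only: relcomp.simps converse_iff embed_at_iff)
  then have "(x, y) \<in> embed_at h O (embed_at k)\<inverse> \<longleftrightarrow> (x, y) \<in> \<alpha> (inv k \<otimes> h)" for x y
    using assms by (metis proj_eq_iff topspace_eq m_closed inv_closed)
  then show ?thesis by auto
qed

lemma embed_at_I_top:
  assumes h: "h \<in> carrier G"
  shows "embed_at h \<in> I_top X (glob G X \<alpha>)"
  unfolding I_top_iff
proof (intro conjI allI impI)
  show "embed_at h \<subseteq> topspace X \<times> topspace (glob G X \<alpha>)"
    using h by (auto simp: embed_at_iff)
  show "single_valued (embed_at h)"
    by (simp add: single_valued_def embed_at_iff)
  show "single_valued ((embed_at h)\<inverse>)"
    using h by (auto simp: single_valued_def embed_at_iff proj_eq_iff one)
  fix U assume U: "openin X U"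
  have "openin X {x \<in> topspace X. proj k x \<in> embed_at h `` U}" if k: "k \<in> carrier G" for k
  proof -
    \<comment> \<open>Seen from the translate at \<open>k\<close>, the embedded copy of
      \<open>U\<close> is its image under a partial homeomorphism, hence open.\<close>
    have "{x \<in> topspace X. proj k x \<in> embed_at h `` U} = \<alpha> (inv k \<otimes> h) `` U"
      by (simp add: embed_at_vimage[symmetric] relcomp_Image[symmetric] embed_at_comp_converse h k)
    then show ?thesis
      using I_top[of "inv k \<otimes> h"] h k U by (simp add: I_top_iff)
  qed
  then show "openin (glob G X \<alpha>) (embed_at h `` U)"
    using h by (auto simp: openin_glob_iff embed_at_iff)
next
  fix V assume "openin (glob G X \<alpha>) V"
  then show "openin X ((embed_at h)\<inverse> `` V)"
    using h by (simp add: openin_glob_iff embed_at_vimage)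
qed

text \<open>\<open>glob_act\<close> translates a whole class and then saturates. The translated
  class lies in a single class, because left multiplication by \<open>g\<close> does not change
  \<open>inv k \<otimes> h\<close>.\<close>

lemma glob_act_proj:
  assumes g: "g \<in> carrier G" and h: "h \<in> carrier G" and x: "x \<in> topspace X"
  shows "glob_act G X \<alpha> g (proj h x) = proj (g \<otimes> h) x"
proof -
  have "(\<lambda>(k, y). (g \<otimes> k, y)) ` proj h x \<subseteq> proj (g \<otimes> h) x"
    using assms by (auto simp: glob_rel_def inv_mult_group m_assoc mult_inv_cancel inv_mult_cancel)
  moreover have "(g \<otimes> h, x) \<in> (\<lambda>(k, y). (g \<otimes> k, y)) ` proj h x"
    using equiv_class_self[OF equiv_glob_rel, of "(h, x)"] h x by force
  ultimately have "glob_rel G X \<alpha> `` ((\<lambda>(k, y). (g \<otimes> k, y)) ` proj h x) = proj (g \<otimes> h) x"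
    using equiv_glob_rel by (auto simp: equiv_def dest: transD)
  then show ?thesis
    using h x by (simp add: glob_act_def)
qed

lemma glob_act_group_action: "group_action G (topspace (glob G X \<alpha>)) (glob_act G X \<alpha>)"
proof -
  let ?E = "topspace (glob G X \<alpha>)" and ?\<phi> = "glob_act G X \<alpha>"
  have closed: "?\<phi> g c \<in> ?E" if "g \<in> carrier G" "c \<in> ?E" for g c
    using that by (auto simp: glob_act_proj elim: globE)
  have mult: "?\<phi> (g \<otimes> h) c = ?\<phi> g (?\<phi> h c)" if "g \<in> carrier G" "h \<in> carrier G" "c \<in> ?E" for g h c
    using that by (auto simp: glob_act_proj m_assoc elim: globE)
  have one: "?\<phi> \<one> c = c" if "c \<in> ?E" for c
    using that by (auto simp: glob_act_proj elim: globE)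
  have bij: "?\<phi> g \<in> Bij ?E" if g: "g \<in> carrier G" for g
  proof -
    have "bij_betw (?\<phi> g) ?E ?E"
      by (rule bij_betw_byWitness[of _ "?\<phi> (inv g)"])
        (use g closed in \<open>auto simp: mult[symmetric] one\<close>)
    then show ?thesis
      by (simp add: Bij_def glob_act_def)
  qed
  have "?\<phi> \<in> hom G (BijGroup ?E)"
  proof (rule homI)
    show "?\<phi> g \<in> carrier (BijGroup ?E)" if "g \<in> carrier G" for g
      using bij[OF that] by (simp add: BijGroup_def)
    show "?\<phi> (g \<otimes> h) = ?\<phi> g \<otimes>\<^bsub>BijGroup ?E\<^esub> ?\<phi> h" if "g \<in> carrier G" "h \<in> carrier G" for g h
    proof
      show "?\<phi> (g \<otimes> h) c = (?\<phi> g \<otimes>\<^bsub>BijGroup ?E\<^esub> ?\<phi> h) c" for c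
        using that bij mult by (cases "c \<in> ?E") (auto simp: BijGroup_def compose_def glob_act_def)
    qed
  qed
  then show ?thesis
    by (simp add: group_action_def group_hom_def group_hom_axioms_def group_BijGroup)
qed

end

sublocale partial_action \<subseteq> glob: group_action G "topspace (glob G X \<alpha>)" "glob_act G X \<alpha>"
  by (rule glob_act_group_action)

context partial_action
begin

lemma glob_act_graph_iff:
  "(c, d) \<in> glob_act_graph G X \<alpha> g \<longleftrightarrow> c \<in> topspace (glob G X \<alpha>) \<and> d = glob_act G X \<alpha> g c"
  by (auto simp: glob_act_graph_def graph_on_def)

lemma embed_at_glob_act:
  assumes "g \<in> carrier G" "h \<in> carrier G"
  shows "embed_at h O glob_act_graph G X \<alpha> g = embed_at (g \<otimes> h)"
  using assms by (auto simp: embed_at_iff glob_act_graph_iff glob_act_proj)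

text \<open>On the translate at \<open>h\<close> the action of \<open>g\<close> is the passage from
  \<open>embed_at h\<close> to \<open>embed_at (g \<otimes> h)\<close>. These partial homeomorphisms
  cover the action, which is injective as part of a group action.\<close>

lemma glob_act_graph_I_top:
  assumes g: "g \<in> carrier G"
  shows "glob_act_graph G X \<alpha> g \<in> I_top (glob G X \<alpha>) (glob G X \<alpha>)"
proof -
  let ?F = "(\<lambda>h. (embed_at h)\<inverse> O embed_at (g \<otimes> h)) ` carrier G"
  have eq: "glob_act_graph G X \<alpha> g = \<Union>?F"
  proof
    show "glob_act_graph G X \<alpha> g \<subseteq> \<Union>?F"
    proof clarify
      fix c d assume "(c, d) \<in> glob_act_graph G X \<alpha> g"
      then obtain h x where "h \<in> carrier G" "x \<in> topspace X" "c = proj h x" "d = proj (g \<otimes> h) x"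
        using g by (auto simp: glob_act_graph_iff glob_act_proj elim: globE)
      then have "(c, d) \<in> (embed_at h)\<inverse> O embed_at (g \<otimes> h)"
        by (intro relcompI[of _ x]) (simp_all add: embed_at_iff)
      then show "(c, d) \<in> \<Union>?F"
        using \<open>h \<in> carrier G\<close> by blast
    qed
    show "\<Union>?F \<subseteq> glob_act_graph G X \<alpha> g"
      using g by (auto simp: glob_act_graph_iff glob_act_proj embed_at_iff)
  qed
  show ?thesis
    unfolding eq
  proof (rule I_top_Union)
    show "u \<in> I_top (glob G X \<alpha>) (glob G X \<alpha>)" if "u \<in> ?F" for u
      using that g by (auto intro!: I_top_comp[OF I_top_converse] embed_at_I_top)
    show "single_valued (\<Union>?F)"
      by (simp add: eq[symmetric] single_valued_def glob_act_graph_iff)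
    show "single_valued ((\<Union>?F)\<inverse>)"
      unfolding eq[symmetric] using glob.inj_prop[OF g]
      by (auto simp: single_valued_def glob_act_graph_iff inj_on_def)
  qed
qed

lemma Hausdorff_glob:
  assumes X: "Hausdorff_space X"
    and pair: "\<And>h x k y. h \<in> carrier G \<Longrightarrow> x \<in> topspace X \<Longrightarrow> k \<in> carrier G \<Longrightarrow> y \<in> topspace X \<Longrightarrow>
      \<exists>g\<in>carrier G. x \<in> Domain (\<alpha> (g \<otimes> h)) \<and> y \<in> Domain (\<alpha> (g \<otimes> k))"
  shows "Hausdorff_space (glob G X \<alpha>)"
  unfolding Hausdorff_space_def
proof (intro allI impI)
  fix c d assume cd: "c \<in> topspace (glob G X \<alpha>) \<and> d \<in> topspace (glob G X \<alpha>) \<and> c \<noteq> d"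
  then obtain h x k y where hk: "h \<in> carrier G" "x \<in> topspace X" "k \<in> carrier G" "y \<in> topspace X"
    and c: "c = proj h x" and d: "d = proj k y"
    by (meson globE)
  then obtain g x' y' where g: "g \<in> carrier G"
    and x': "(x, x') \<in> \<alpha> (g \<otimes> h)" and y': "(y, y') \<in> \<alpha> (g \<otimes> k)"
    using pair[OF hk] by (auto simp: Domain_iff)
  \<comment> \<open>That \<open>g\<close> moves both points into the copy of \<open>X\<close> means
    that both lie in the translate at \<open>inv g\<close>; disjoint neighbourhoods in
    \<open>X\<close> are transported there by the open injective map
    \<open>embed_at k'\<close>.\<close>
  define k' where "k' = inv g"
  have k': "k' \<in> carrier G" using g by (simp add: k'_def)
  have top: "x' \<in> topspace X" "y' \<in> topspace X"
    using x' y' g hk topspace_eq by auto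
  have c': "c = proj k' x'" "d = proj k' y'"
    using x' y' g hk top by (simp_all add: c d proj_eq_iff k'_def)
  with cd have "x' \<noteq> y'" by blast
  then obtain U V where UV: "openin X U" "openin X V" "x' \<in> U" "y' \<in> V" "disjnt U V"
    using X top unfolding Hausdorff_space_def by blast
  have e: "embed_at k' \<in> I_top X (glob G X \<alpha>)"
    using k' by (rule embed_at_I_top)
  show "\<exists>U V. openin (glob G X \<alpha>) U \<and> openin (glob G X \<alpha>) V \<and> c \<in> U \<and> d \<in> V \<and> disjnt U V"
  proof (intro exI conjI)
    show "openin (glob G X \<alpha>) (embed_at k' `` U)" "openin (glob G X \<alpha>) (embed_at k' `` V)"
      using e UV by (simp_all add: I_top_iff)
    show "c \<in> embed_at k' `` U" "d \<in> embed_at k' `` V"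
      using UV top by (auto simp: embed_at_iff c')
    have sv: "single_valued ((embed_at k')\<inverse>)" using e by (simp add: I_top_iff)
    show "disjnt (embed_at k' `` U) (embed_at k' `` V)"
      using UV(5) unfolding disjnt_iff by (auto dest: single_valuedD[OF sv converseI converseI])
  qed
qed

end

section \<open>The structure on the globalization\<close>

lemma S_hat_Union:
  assumes "u \<in> I_top A A" "\<And>s. s \<in> F \<Longrightarrow> s \<in> S_hat A S" "u = \<Union>F"
  shows "u \<in> S_hat A S"
proof -
  have "\<forall>s\<in>F. \<exists>F'. F' \<subseteq> S \<and> s = \<Union>F'"
    using assms(2) by (auto simp: S_hat_def)
  then obtain F' where F': "\<forall>s\<in>F. F' s \<subseteq> S \<and> s = \<Union>(F' s)"
    by metis
  show ?thesis
  proof (rule S_hatI[OF assms(1)])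
    show "\<Union>(F' ` F) \<subseteq> S" using F' by blast
    have "(\<Union>s\<in>F. \<Union>(F' s)) = (\<Union>s\<in>F. s)"
      using F' by (intro SUP_cong) metis+
    moreover have "\<Union>(\<Union>(F' ` F)) = (\<Union>s\<in>F. \<Union>(F' s))" by blast
    ultimately show "u = \<Union>(\<Union>(F' ` F))" using assms(3) by simp
  qed
qed

locale S_partial_action = partial_action G X \<alpha>
  for G :: "('g, 'm) monoid_scheme" (structure) and X :: "'x topology" and \<alpha> +
  fixes A :: "'a topology" and S :: "('a \<times> 'a) set set" and \<H> :: "('x \<times> 'a) set set"
  assumes pseudogroup: "pseudogroup A S"
    and is_structure: "S_structure A S X \<H>"
    and preserving: "g \<in> carrier G \<Longrightarrow> \<alpha> g \<in> I_S X \<H> X \<H>"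
begin

text \<open>Testing against every translate, instead of generating a structure from transported
  charts, makes completeness and invariance direct. The price is that the existence of enough charts
  needs an argument, given by \<open>transported_chart\<close>.\<close>

definition glob_charts :: "(('g \<times> 'x) set \<times> 'a) set set" where
  "glob_charts = {f \<in> I_top (glob G X \<alpha>) A. \<forall>h\<in>carrier G. embed_at h O f \<in> \<H>}"

lemma embed_at_comp_chart: "f \<in> glob_charts \<Longrightarrow> h \<in> carrier G \<Longrightarrow> embed_at h O f \<in> \<H>"
  by (simp add: glob_charts_def)

text \<open>Seen from the translate at \<open>k\<close>, the transported chart is \<open>f\<close>
  pulled back along \<open>\<alpha> (inv h \<otimes> k)\<close>, so it is a chart because the
  partial action preserves the structure.\<close>

lemma transported_chart:
  assumes h: "h \<in> carrier G" and f: "f \<in> \<H>"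
  shows "(embed_at h)\<inverse> O f \<in> glob_charts"
proof -
  have "(embed_at h)\<inverse> O f \<in> I_top (glob G X \<alpha>) A"
    using I_top_converse[OF embed_at_I_top[OF h]] S_structure_I_top[OF is_structure f]
    by (rule I_top_comp)
  moreover have "embed_at k O ((embed_at h)\<inverse> O f) \<in> \<H>" if k: "k \<in> carrier G" for k
  proof -
    have "\<alpha> (inv h \<otimes> k) O f \<in> \<H>"
      using h k f by (intro I_S_pullback[OF is_structure is_structure] preserving) auto
    then show ?thesis
      by (simp add: O_assoc[symmetric] embed_at_comp_converse h k)
  qed
  ultimately show ?thesis
    by (simp add: glob_charts_def)
qed

text \<open>Every point of the globalization lies in some translate, so the transition map is the
  union of transition maps between pullbacks, which are charts of \<open>X\<close>.\<close>

lemma glob_charts_transition: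
  assumes f: "f \<in> glob_charts" and f': "f' \<in> glob_charts"
  shows "f\<inverse> O f' \<in> S_hat A S"
proof (rule S_hat_Union)
  let ?F = "(\<lambda>h. (embed_at h O f)\<inverse> O (embed_at h O f')) ` carrier G"
  have ft: "f \<in> I_top (glob G X \<alpha>) A" "f' \<in> I_top (glob G X \<alpha>) A"
    using f f' by (simp_all add: glob_charts_def)
  then show "f\<inverse> O f' \<in> I_top A A"
    by (intro I_top_comp[OF I_top_converse])
  show "s \<in> S_hat A S" if "s \<in> ?F" for s
    using that f f' is_structure by (auto simp: glob_charts_def intro!: S_structure_transition)
  show "f\<inverse> O f' = \<Union>?F"
  proof
    show "f\<inverse> O f' \<subseteq> \<Union>?F"
    proof clarify
      fix a c b assume c: "(c, a) \<in> f" "(c, b) \<in> f'"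
      then have "c \<in> topspace (glob G X \<alpha>)"
        using I_top_subset[OF ft(1)] by blast
      then obtain h x where "h \<in> carrier G" "(x, c) \<in> embed_at h"
        by (auto simp: embed_at_iff elim: globE)
      with c show "(a, b) \<in> \<Union>?F" by blast
    qed
    show "\<Union>?F \<subseteq> f\<inverse> O f'"
      by (auto simp: embed_at_iff)
  qed
qed

lemma S_structure_glob_charts: "S_structure A S (glob G X \<alpha>) glob_charts"
proof -
  have "{} \<in> glob_charts"
    using S_structure_empty[OF is_structure] by (simp add: glob_charts_def I_top_iff single_valued_def)
  moreover have "\<Union>(Domain ` glob_charts) = topspace (glob G X \<alpha>)"
  proof
    show "\<Union>(Domain ` glob_charts) \<subseteq> topspace (glob G X \<alpha>)"
      by (force simp: glob_charts_def dest: I_top_subset)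
    show "topspace (glob G X \<alpha>) \<subseteq> \<Union>(Domain ` glob_charts)"
    proof
      fix c assume "c \<in> topspace (glob G X \<alpha>)"
      then obtain h x where hx: "h \<in> carrier G" "x \<in> topspace X" "c = proj h x"
        by (rule globE)
      obtain f a where f: "f \<in> \<H>" "(x, a) \<in> f"
        using is_structure hx(2) by (rule S_structure_chartE)
      have "(c, a) \<in> (embed_at h)\<inverse> O f"
        using f hx by (intro relcompI[of _ x]) (simp_all add: embed_at_iff)
      then show "c \<in> \<Union>(Domain ` glob_charts)"
        using transported_chart[OF hx(1) f(1)] by blast
    qed
  qed
  moreover have "f O u \<in> glob_charts" if f: "f \<in> glob_charts" and u: "u \<in> S" for f u
  proof -
    have "u \<in> I_top A A" using pseudogroup u by (auto simp: pseudogroup_def)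
    then show ?thesis
      using f u is_structure
      by (auto simp: glob_charts_def O_assoc[symmetric] intro: I_top_comp S_structure_comp)
  qed
  moreover have "\<Union>F \<in> glob_charts" if F: "F \<subseteq> glob_charts" and UF: "\<Union>F \<in> I_top (glob G X \<alpha>) A" for F
  proof -
    have "embed_at h O \<Union>F \<in> \<H>" if h: "h \<in> carrier G" for h
    proof -
      have eq: "embed_at h O \<Union>F = \<Union>((\<lambda>f. embed_at h O f) ` F)" by blast
      have "(\<lambda>f. embed_at h O f) ` F \<subseteq> \<H>"
        using F h by (auto simp: glob_charts_def)
      moreover have "\<Union>((\<lambda>f. embed_at h O f) ` F) \<in> I_top X A"
        unfolding eq[symmetric] using embed_at_I_top[OF h] UF by (rule I_top_comp)
      ultimately show ?thesis
        unfolding eq by (rule S_structure_Union[OF is_structure])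
    qed
    with UF show ?thesis by (simp add: glob_charts_def)
  qed
  ultimately show ?thesis
    using glob_charts_transition by (simp add: S_structure_def S_atlas_def) (auto simp: glob_charts_def)
qed

lemma embed_at_I_S: "h \<in> carrier G \<Longrightarrow> embed_at h \<in> I_S X \<H> (glob G X \<alpha>) glob_charts"
  by (simp add: I_S_iff[OF is_structure S_structure_glob_charts] embed_at_I_top embed_at_comp_chart)

text \<open>Pulling back along the action of \<open>g\<close> only permutes the tests: the one at
  \<open>h\<close> becomes the one at \<open>g \<otimes> h\<close>.\<close>

lemma glob_act_comp_chart:
  assumes "g \<in> carrier G" "f \<in> glob_charts"
  shows "glob_act_graph G X \<alpha> g O f \<in> glob_charts"
  using assms glob_act_graph_I_top
  by (auto simp: glob_charts_def O_assoc[symmetric] embed_at_glob_act intro: I_top_comp)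

lemma glob_act_I_S:
  "g \<in> carrier G \<Longrightarrow>
    glob_act_graph G X \<alpha> g \<in> I_S (glob G X \<alpha>) glob_charts (glob G X \<alpha>) glob_charts"
  using glob_act_graph_I_top glob_act_comp_chart
  by (simp add: I_S_iff[OF S_structure_glob_charts S_structure_glob_charts])

lemma glob_structure_glob_charts: "glob_structure A S G X \<H> \<alpha> glob_charts"
proof -
  let ?R = "glob_embed G X \<alpha> ` topspace X"
  have R: "?R = Range (embed_at \<one>)"
    by (auto simp: Range_iff embed_at_iff glob_embed_def)
  have "restrict_structure glob_charts ?R = (\<lambda>f. (embed_at \<one>)\<inverse> O f) ` \<H>"
  proof
    show "restrict_structure glob_charts ?R \<subseteq> (\<lambda>f. (embed_at \<one>)\<inverse> O f) ` \<H>"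
    proof
      fix f assume "f \<in> restrict_structure glob_charts ?R"
      then have f: "f \<in> glob_charts" "Domain f \<subseteq> Range (embed_at \<one>)"
        by (auto simp: restrict_structure_def R)
      \<comment> \<open>A chart inside the copy of \<open>X\<close> is recovered from its pullback
        to \<open>X\<close>; this is the inclusion that needs \<open>Domain f\<close> inside that
        copy.\<close>
      have "f = (embed_at \<one>)\<inverse> O (embed_at \<one> O f)"
      proof
        show "f \<subseteq> (embed_at \<one>)\<inverse> O (embed_at \<one> O f)"
        proof clarify
          fix c a assume "(c, a) \<in> f"
          moreover from this obtain x where "(x, c) \<in> embed_at \<one>"
            using f(2) by blast
          ultimately show "(c, a) \<in> (embed_at \<one>)\<inverse> O (embed_at \<one> O f)" by blast
        qed
        show "(embed_at \<one>)\<inverse> O (embed_at \<one> O f) \<subseteq> f" by (auto simp: embed_at_iff)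
      qed
      moreover have "embed_at \<one> O f \<in> \<H>" using f(1) by (simp add: glob_charts_def)
      ultimately show "f \<in> (\<lambda>f. (embed_at \<one>)\<inverse> O f) ` \<H>" by blast
    qed
    show "(\<lambda>f. (embed_at \<one>)\<inverse> O f) ` \<H> \<subseteq> restrict_structure glob_charts ?R"
      using transported_chart[OF one_closed] by (auto simp: restrict_structure_def R)
  qed
  then show ?thesis
    using S_structure_glob_charts glob_act_comp_chart
    by (simp add: glob_structure_def glob_embed_graph_eq)
qed

end

section \<open>The group of parcelwise transformations\<close>

text \<open>Exceptional points stay finite in number when pushed or pulled along partial bijections;
  the cofiniteness of composites and conjugates rests on this.\<close>

lemma finite_Image_single_valued:
  assumes "single_valued r" "finite B"
  shows "finite (r `` B)"
proof -
  have "r `` {x} \<subseteq> {THE y. (x, y) \<in> r}" for x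
    using assms(1) by (auto simp: single_valued_def intro!: the_equality[symmetric])
  then have "r `` B \<subseteq> (\<lambda>x. THE y. (x, y) \<in> r) ` B" by blast
  then show ?thesis
    using assms(2) by (meson finite_imageI finite_subset)
qed

lemma openin_cofinite:
  assumes "Hausdorff_space X" "Y \<subseteq> topspace X" "finite (topspace X - Y)"
  shows "openin X Y"
proof -
  have "closedin X (topspace X - Y)"
    using assms Hausdorff_imp_t1_space t1_space_closedin_finite by blast
  then show ?thesis
    using assms(2) by (simp add: closedin_def double_diff)
qed

text \<open>A chart would carry an isolated point to an isolated point of \<open>A\<close>. The
  globalization inherits the property in the same way as \<open>X\<close>.\<close>

lemma S_structure_no_isolated_points:
  assumes "S_structure A S X \<H>" and A: "\<forall>a\<in>topspace A. \<not> openin A {a}" and x: "x \<in> topspace X"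
  shows "\<not> openin X {x}"
proof
  assume "openin X {x}"
  obtain f a where f: "f \<in> \<H>" "(x, a) \<in> f"
    using assms(1) x by (rule S_structure_chartE)
  then have ft: "f \<in> I_top X A" using assms(1) S_structure_I_top by metis
  then have "openin A (f `` {x})" using \<open>openin X {x}\<close> by (simp add: I_top_iff)
  moreover have "f `` {x} = {a}"
    using ft f(2) by (auto simp: I_top_iff dest: single_valuedD)
  moreover have "a \<in> topspace A" using I_top_subset[OF ft] f(2) by blast
  ultimately show False using A by simp
qed

text \<open>Meant for two instances: \<open>X\<close> itself and, once it is known to be Hausdorff,
  the globalization of \<open>Y\<close>.\<close>

locale S_modeled_Hausdorff =
  fixes A :: "'a topology" and S :: "('a \<times> 'a) set set" and X :: "'x topology" and \<H> :: "('x \<times> 'a) set set"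
  assumes pseudogroup: "pseudogroup A S"
    and is_structure: "S_structure A S X \<H>"
    and Hausdorff: "Hausdorff_space X"
    and no_isolated: "x \<in> topspace X \<Longrightarrow> \<not> openin X {x}"
begin

abbreviation "CH \<equiv> cofinite_homeos X \<H>"
abbreviation "R \<equiv> PC_rel X \<H>"

lemma cofinite_homeosD:
  assumes "u \<in> CH"
  shows "u \<in> I_S X \<H> X \<H>" "u \<in> I_top X X" "u \<subseteq> topspace X \<times> topspace X" "single_valued u"
    "single_valued (u\<inverse>)" "finite (topspace X - Domain u)" "finite (topspace X - Range u)"
proof -
  show u: "u \<in> I_S X \<H> X \<H>" and "finite (topspace X - Domain u)" "finite (topspace X - Range u)"
    using assms by (simp_all add: cofinite_homeos_def)
  show "u \<in> I_top X X" using u by (rule I_S_I_top)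
  then show "u \<subseteq> topspace X \<times> topspace X" "single_valued u" "single_valued (u\<inverse>)"
    by (simp_all add: I_top_iff)
qed

lemma cofinite_homeos_Id: "Id_on (topspace X) \<in> CH"
  using I_S_Id[OF is_structure] by (simp add: cofinite_homeos_def)

lemma cofinite_homeos_converse: "u \<in> CH \<Longrightarrow> u\<inverse> \<in> CH"
  by (simp add: cofinite_homeos_def I_S_converse)

lemma cofinite_homeos_comp:
  assumes u: "u \<in> CH" and v: "v \<in> CH"
  shows "u O v \<in> CH"
proof -
  have "u O v \<in> I_S X \<H> X \<H>"
    using is_structure is_structure is_structure cofinite_homeosD(1)[OF u] cofinite_homeosD(1)[OF v]
    by (rule I_S_comp)
  moreover have "finite (topspace X - Domain (u O v))"
  proof (rule finite_subset)
    show "topspace X - Domain (u O v) \<subseteq> (topspace X - Domain u) \<union> u\<inverse> `` (topspace X - Domain v)"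
      using cofinite_homeosD(3)[OF u] by blast
    show "finite \<dots>"
      using cofinite_homeosD[OF u] cofinite_homeosD[OF v] by (simp add: finite_Image_single_valued)
  qed
  moreover have "finite (topspace X - Range (u O v))"
  proof (rule finite_subset)
    show "topspace X - Range (u O v) \<subseteq> (topspace X - Range v) \<union> v `` (topspace X - Range u)"
      using cofinite_homeosD(3)[OF v] by blast
    show "finite \<dots>"
      using cofinite_homeosD[OF u] cofinite_homeosD[OF v] by (simp add: finite_Image_single_valued)
  qed
  ultimately show ?thesis
    by (simp add: cofinite_homeos_def)
qed

lemma PC_relE:
  assumes "(u, v) \<in> R"
  obtains D where "u \<in> CH" "v \<in> CH" "D \<subseteq> Domain u \<inter> Domain v" "finite (topspace X - D)"
    "\<And>x. x \<in> D \<Longrightarrow> u `` {x} = v `` {x}"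
  using assms by (auto simp: PC_rel_def)

lemma PC_relI:
  assumes "u \<in> CH" "v \<in> CH" "D \<subseteq> Domain u \<inter> Domain v" "finite (topspace X - D)"
    "\<And>x. x \<in> D \<Longrightarrow> u `` {x} = v `` {x}"
  shows "(u, v) \<in> R"
  using assms by (auto simp: PC_rel_def)

text \<open>
  The cofinite set on which two representatives agree is dense, since \<open>X\<close> has no isolated point.
\<close>

lemma PC_rel_agree:
  assumes uv: "(u, v) \<in> R" and y: "(x, y) \<in> u" and z: "(x, z) \<in> v"
  shows "y = z"
proof (rule ccontr)
  assume "y \<noteq> z"
  obtain D where u: "u \<in> CH" and v: "v \<in> CH" and D: "finite (topspace X - D)"
    and eq: "\<And>x. x \<in> D \<Longrightarrow> u `` {x} = v `` {x}"
    using uv by (rule PC_relE) blast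
  have x: "x \<in> topspace X" and "y \<in> topspace X" "z \<in> topspace X"
    using y z cofinite_homeosD(3)[OF u] cofinite_homeosD(3)[OF v] by auto
  then obtain V W where VW: "openin X V" "openin X W" "y \<in> V" "z \<in> W" "disjnt V W"
    using Hausdorff \<open>y \<noteq> z\<close> unfolding Hausdorff_space_def by metis
  \<comment> \<open>On this neighbourhood of \<open>x\<close> the values of \<open>u\<close> and
    \<open>v\<close> lie in disjoint sets, so \<open>N\<close> avoids the set \<open>D\<close> of
    agreement and is finite. Removing its other points, a closed set, would leave \<open>x\<close>
    isolated.\<close>
  define N where "N = u\<inverse> `` V \<inter> v\<inverse> `` W"
  have N: "openin X N" "x \<in> N"
    using cofinite_homeosD(2)[OF u] cofinite_homeosD(2)[OF v] VW y z by (auto simp: I_top_iff N_def)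
  have "t \<notin> N" if t: "t \<in> D" for t
  proof
    assume "t \<in> N"
    then obtain a b where ab: "(t, a) \<in> u" "(t, b) \<in> v" "a \<in> V" "b \<in> W"
      by (auto simp: N_def)
    then have "(t, b) \<in> u" using eq[OF t] by blast
    then have "a = b" using ab(1) cofinite_homeosD(4)[OF u] by (auto dest: single_valuedD)
    with ab VW(5) show False by (auto simp: disjnt_iff)
  qed
  then have "N \<subseteq> topspace X - D" using openin_subset[OF N(1)] by blast
  then have "finite (N - {x})" using D by (meson finite_Diff finite_subset)
  then have "closedin X (N - {x})"
    using openin_subset[OF N(1)] Hausdorff Hausdorff_imp_t1_space t1_space_closedin_finite by blast
  then have "openin X (N - (N - {x}))" using N(1) by (rule openin_diff[rotated])
  moreover have "N - (N - {x}) = {x}" using N(2) by blast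
  ultimately show False using no_isolated[OF x] by simp
qed

text \<open>Replaces the search for a cofinite set of agreement by a pointwise test on the common
  domain, which is itself cofinite and serves as witness.\<close>

lemma PC_rel_iff:
  assumes u: "u \<in> CH" and v: "v \<in> CH"
  shows "(u, v) \<in> R \<longleftrightarrow> (\<forall>x y z. (x, y) \<in> u \<and> (x, z) \<in> v \<longrightarrow> y = z)"
proof
  show "(u, v) \<in> R \<Longrightarrow> \<forall>x y z. (x, y) \<in> u \<and> (x, z) \<in> v \<longrightarrow> y = z"
    using PC_rel_agree by blast
  assume agree: "\<forall>x y z. (x, y) \<in> u \<and> (x, z) \<in> v \<longrightarrow> y = z"
  show "(u, v) \<in> R"
  proof (rule PC_relI[OF u v order_refl])
    show "finite (topspace X - Domain u \<inter> Domain v)"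
      using cofinite_homeosD(6)[OF u] cofinite_homeosD(6)[OF v] by (simp add: Diff_Int)
    show "u `` {x} = v `` {x}" if x: "x \<in> Domain u \<inter> Domain v" for x
    proof -
      obtain y z where "(x, y) \<in> u" "(x, z) \<in> v" using x by blast
      with agree show ?thesis by blast
    qed
  qed
qed

text \<open>The pointwise criterion does not pass to converses directly, since a common value of
  \<open>u\<close> and \<open>v\<close> may be taken at points where only one of them is defined.
  The witness is instead the image under \<open>u\<close> of the cofinite set of agreement.\<close>

lemma PC_rel_converse:
  assumes uv: "(u, v) \<in> R"
  shows "(u\<inverse>, v\<inverse>) \<in> R"
proof -
  obtain D where u: "u \<in> CH" and v: "v \<in> CH" and D: "finite (topspace X - D)" and eq: "\<And>x. x \<in> D \<Longrightarrow> u `` {x} = v `` {x}"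
    using uv by (rule PC_relE) blast
  show ?thesis
  proof (rule PC_relI)
    show "u\<inverse> \<in> CH" "v\<inverse> \<in> CH" using u v by (simp_all add: cofinite_homeos_converse)
    have eqD: "(x, y) \<in> u \<longleftrightarrow> (x, y) \<in> v" if "x \<in> D" for x y using eq[OF that] by blast
    show "u `` D \<subseteq> Domain (u\<inverse>) \<inter> Domain (v\<inverse>)" using eqD by blast
    show "finite (topspace X - u `` D)"
    proof (rule finite_subset)
      show "topspace X - u `` D \<subseteq> (topspace X - Range u) \<union> u `` (topspace X - D)"
        using cofinite_homeosD(3)[OF u] by blast
      show "finite \<dots>"
        using D cofinite_homeosD[OF u] by (simp add: finite_Image_single_valued)
    qed
    show "u\<inverse> `` {y} = v\<inverse> `` {y}" if y: "y \<in> u `` D" for y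
    proof -
      obtain x where x: "x \<in> D" "(x, y) \<in> u" using y by blast
      then have xv: "(x, y) \<in> v" using eqD by simp
      have "u\<inverse> `` {y} = {x}" using x(2) cofinite_homeosD(5)[OF u] by (auto dest: single_valuedD)
      moreover have "v\<inverse> `` {y} = {x}" using xv cofinite_homeosD(5)[OF v] by (auto dest: single_valuedD)
      ultimately show ?thesis by simp
    qed
  qed
qed

lemma PC_rel_comp:
  assumes "(u, u') \<in> R" "(v, v') \<in> R"
  shows "(u O v, u' O v') \<in> R"
proof -
  have "u \<in> CH" "u' \<in> CH" "v \<in> CH" "v' \<in> CH"
    using assms by (auto elim: PC_relE)
  moreover have "z = z'" if "(x, z) \<in> u O v" "(x, z') \<in> u' O v'" for x z z'
    using that PC_rel_agree[OF assms(1)] PC_rel_agree[OF assms(2)] by blast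
  ultimately show ?thesis
    by (auto simp: PC_rel_iff cofinite_homeos_comp)
qed

lemma equiv_PC_rel: "equiv CH R"
proof (rule equivI)
  show "R \<subseteq> CH \<times> CH" by (auto simp: PC_rel_def)
  show "refl_on CH R"
    by (auto simp: refl_on_def PC_rel_iff dest: cofinite_homeosD(4) single_valuedD)
  show "sym R"
  proof (rule symI)
    fix u v assume "(u, v) \<in> R"
    then obtain D where "u \<in> CH" "v \<in> CH" "D \<subseteq> Domain v \<inter> Domain u" "finite (topspace X - D)"
      "\<And>x. x \<in> D \<Longrightarrow> v `` {x} = u `` {x}"
      by (rule PC_relE) auto
    then show "(v, u) \<in> R" by (intro PC_relI)
  qed
  show "trans R"
  proof (rule transI)
    fix u v w assume "(u, v) \<in> R" "(v, w) \<in> R"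
    then obtain D D' where
      D: "u \<in> CH" "D \<subseteq> Domain u \<inter> Domain v" "finite (topspace X - D)" "\<And>x. x \<in> D \<Longrightarrow> u `` {x} = v `` {x}"
      and D': "w \<in> CH" "D' \<subseteq> Domain v \<inter> Domain w" "finite (topspace X - D')" "\<And>x. x \<in> D' \<Longrightarrow> v `` {x} = w `` {x}"
      by (metis PC_relE)
    \<comment> \<open>Agreement on common domains says nothing where \<open>v\<close> is undefined,
      so transitivity goes back to the cofinite sets and intersects them.\<close>
    show "(u, w) \<in> R"
    proof (rule PC_relI[of _ _ "D \<inter> D'"])
      show "D \<inter> D' \<subseteq> Domain u \<inter> Domain w" using D(2) D'(2) by blast
      show "finite (topspace X - D \<inter> D')" using D(3) D'(3) by (simp add: Diff_Int)
    qed (use D D' in auto)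
  qed
qed

section \<open>The group of classes and its partial action\<close>

lemma PC_carrier: "carrier (PC X \<H>) = CH // R"
  by (simp add: PC_def)

lemma PC_one: "\<one>\<^bsub>PC X \<H>\<^esub> = R `` {Id_on (topspace X)}"
  by (simp add: PC_def)

text \<open>The product is a union over all pairs of representatives; congruence makes all its terms
  equal, so one pair computes it.\<close>

lemma PC_mult:
  assumes "u \<in> CH" "v \<in> CH"
  shows "R `` {u} \<otimes>\<^bsub>PC X \<H>\<^esub> R `` {v} = R `` {v O u}"
proof -
  have "congruent2 R R (\<lambda>u v. R `` {v O u})"
    by (rule congruent2I') (meson PC_rel_comp equiv_PC_rel equiv_class_eq)
  then show ?thesis
    using UN_equiv_class2[OF equiv_PC_rel equiv_PC_rel _ assms] by (simp add: PC_def)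
qed

lemma PC_in_carrier: "u \<in> CH \<Longrightarrow> R `` {u} \<in> carrier (PC X \<H>)"
  by (simp add: PC_carrier quotientI)

lemma PC_carrierE:
  assumes "g \<in> carrier (PC X \<H>)"
  obtains u where "u \<in> CH" "g = R `` {u}"
  using assms by (auto simp: PC_carrier elim: quotientE)

text \<open>The composite is only a restriction of the identity, but a cofinite one, and so has the
  same class.\<close>

lemma PC_inverse_mult:
  assumes u: "u \<in> CH"
  shows "R `` {u\<inverse>} \<otimes>\<^bsub>PC X \<H>\<^esub> R `` {u} = \<one>\<^bsub>PC X \<H>\<^esub>"
proof -
  have "u O u\<inverse> \<subseteq> Id_on (topspace X)"
    using cofinite_homeosD(3)[OF u] single_valuedD[OF cofinite_homeosD(5)[OF u]] by blast
  then have "(u O u\<inverse>, Id_on (topspace X)) \<in> R"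
    using u by (subst PC_rel_iff) (auto intro: cofinite_homeos_comp cofinite_homeos_converse cofinite_homeos_Id)
  then show ?thesis
    using u by (simp add: PC_mult PC_one cofinite_homeos_converse equiv_class_eq[OF equiv_PC_rel])
qed

lemma group_PC: "group (PC X \<H>)"
proof (rule groupI)
  let ?G = "PC X \<H>"
  show "g \<otimes>\<^bsub>?G\<^esub> h \<in> carrier ?G" if "g \<in> carrier ?G" "h \<in> carrier ?G" for g h
    using that by (auto elim!: PC_carrierE simp: PC_mult intro!: PC_in_carrier cofinite_homeos_comp)
  show "\<one>\<^bsub>?G\<^esub> \<in> carrier ?G"
    by (simp add: PC_one PC_in_carrier cofinite_homeos_Id)
  show "g \<otimes>\<^bsub>?G\<^esub> h \<otimes>\<^bsub>?G\<^esub> k = g \<otimes>\<^bsub>?G\<^esub> (h \<otimes>\<^bsub>?G\<^esub> k)"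
    if "g \<in> carrier ?G" "h \<in> carrier ?G" "k \<in> carrier ?G" for g h k
    using that by (auto elim!: PC_carrierE simp: PC_mult cofinite_homeos_comp O_assoc)
  show "\<one>\<^bsub>?G\<^esub> \<otimes>\<^bsub>?G\<^esub> g = g" if g: "g \<in> carrier ?G" for g
  proof -
    obtain u where u: "u \<in> CH" "g = R `` {u}" using g by (rule PC_carrierE)
    moreover have "u O Id_on (topspace X) = u"
      using cofinite_homeosD(3)[OF u(1)] by blast
    ultimately show ?thesis by (simp add: PC_one PC_mult cofinite_homeos_Id)
  qed
  show "\<exists>h\<in>carrier ?G. h \<otimes>\<^bsub>?G\<^esub> g = \<one>\<^bsub>?G\<^esub>" if g: "g \<in> carrier ?G" for g
  proof -
    obtain u where "u \<in> CH" "g = R `` {u}" using g by (rule PC_carrierE)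
    then show ?thesis
      by (metis PC_inverse_mult PC_in_carrier cofinite_homeos_converse)
  qed
qed

lemma PC_inv: "u \<in> CH \<Longrightarrow> inv\<^bsub>PC X \<H>\<^esub> (R `` {u}) = R `` {u\<inverse>}"
  by (intro group.inv_equality[OF group_PC] PC_inverse_mult PC_in_carrier cofinite_homeos_converse)

lemma PC_memberD:
  assumes "g \<in> carrier (PC X \<H>)" "u \<in> g"
  shows "u \<in> CH" "g = R `` {u}"
proof -
  obtain v where v: "v \<in> CH" "g = R `` {v}" using assms(1) by (rule PC_carrierE)
  with assms(2) have vu: "(v, u) \<in> R" by simp
  then show "u \<in> CH" by (rule PC_relE)
  show "g = R `` {u}" using v(2) equiv_class_eq[OF equiv_PC_rel vu] by simp
qed

lemma PC_member_rel: "g \<in> carrier (PC X \<H>) \<Longrightarrow> u \<in> g \<Longrightarrow> v \<in> g \<Longrightarrow> (u, v) \<in> R"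
  using PC_memberD(2) by blast

text \<open>Any two representatives agree on their common domain, and so do their converses; hence
  the union over the class is single-valued in both directions.\<close>

lemma alpha_S_I_S:
  assumes g: "g \<in> carrier (PC X \<H>)"
  shows "alpha_S g \<in> I_S X \<H> X \<H>"
  unfolding alpha_S_def
proof (rule I_S_Union[OF is_structure is_structure])
  show "u \<in> I_S X \<H> X \<H>" if "u \<in> g" for u
    using PC_memberD(1)[OF g that] by (rule cofinite_homeosD)
  show "single_valued (\<Union>g)"
    using PC_rel_agree[OF PC_member_rel[OF g]] unfolding single_valued_def by blast
  show "single_valued ((\<Union>g)\<inverse>)"
    using PC_rel_agree[OF PC_rel_converse[OF PC_member_rel[OF g]]]
    unfolding single_valued_def by blast
qed

lemma alpha_S_one: "alpha_S \<one>\<^bsub>PC X \<H>\<^esub> = Id_on (topspace X)"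
proof
  have "(Id_on (topspace X), Id_on (topspace X)) \<in> R"
    using equiv_PC_rel cofinite_homeos_Id by (auto simp: equiv_def refl_on_def)
  then show "Id_on (topspace X) \<subseteq> alpha_S \<one>\<^bsub>PC X \<H>\<^esub>"
    unfolding alpha_S_def PC_one by blast
  \<comment> \<open>The identity is defined everywhere, so a map equivalent to it agrees with it on
    its entire domain.\<close>
  have Id: "y = x \<and> x \<in> topspace X" if "(Id_on (topspace X), u) \<in> R" "(x, y) \<in> u" for u x y
  proof -
    have "u \<in> CH" using that(1) by (rule PC_relE)
    then have "x \<in> topspace X" using cofinite_homeosD(3) that(2) by blast
    then show ?thesis using PC_rel_agree[OF that(1) _ that(2)] by blast
  qed
  show "alpha_S \<one>\<^bsub>PC X \<H>\<^esub> \<subseteq> Id_on (topspace X)"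
  proof (rule subrelI)
    fix x y assume "(x, y) \<in> alpha_S \<one>\<^bsub>PC X \<H>\<^esub>"
    then obtain u where "(Id_on (topspace X), u) \<in> R" "(x, y) \<in> u"
      unfolding alpha_S_def PC_one by blast
    then show "(x, y) \<in> Id_on (topspace X)" using Id[of u x y] by auto
  qed
qed

lemma alpha_S_inverse:
  assumes g: "g \<in> carrier (PC X \<H>)"
  shows "alpha_S (inv\<^bsub>PC X \<H>\<^esub> g) = (alpha_S g)\<inverse>"
proof -
  obtain u where u: "u \<in> CH" "g = R `` {u}" using g by (rule PC_carrierE)
  have rel: "(u\<inverse>, v\<inverse>) \<in> R \<longleftrightarrow> (u, v) \<in> R" for v
    using PC_rel_converse[of "u\<inverse>" "v\<inverse>"] PC_rel_converse[of u v] by auto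
  have "\<Union>(R `` {u\<inverse>}) = (\<Union>(R `` {u}))\<inverse>"
  proof (intro subset_antisym subrelI)
    fix x y assume "(x, y) \<in> \<Union>(R `` {u\<inverse>})"
    then obtain v where v: "(u\<inverse>, v) \<in> R" "(x, y) \<in> v" by blast
    then have "(u, v\<inverse>) \<in> R" "(y, x) \<in> v\<inverse>" using rel[of "v\<inverse>"] by simp_all
    then show "(x, y) \<in> (\<Union>(R `` {u}))\<inverse>" by blast
  next
    fix x y assume "(x, y) \<in> (\<Union>(R `` {u}))\<inverse>"
    then obtain v where v: "(u, v) \<in> R" "(y, x) \<in> v" by blast
    then have "(u\<inverse>, v\<inverse>) \<in> R" "(x, y) \<in> v\<inverse>" using rel[of v] by simp_all
    then show "(x, y) \<in> \<Union>(R `` {u\<inverse>})" by blast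
  qed
  then show ?thesis
    using u by (simp add: PC_inv alpha_S_def)
qed

text \<open>A pair on the left already arises from one representative of each factor, and their
  composite represents the product. The product may have representatives with larger domains, hence
  an inclusion.\<close>

lemma alpha_S_mult:
  assumes g: "g \<in> carrier (PC X \<H>)" and h: "h \<in> carrier (PC X \<H>)"
  shows "alpha_S h O alpha_S g \<subseteq> alpha_S (g \<otimes>\<^bsub>PC X \<H>\<^esub> h)"
proof -
  have "v O u \<in> g \<otimes>\<^bsub>PC X \<H>\<^esub> h" if "u \<in> g" "v \<in> h" for u v
  proof -
    have u: "u \<in> CH" "g = R `` {u}" and v: "v \<in> CH" "h = R `` {v}"
      by (fact PC_memberD[OF g that(1)] PC_memberD[OF h that(2)])+
    have "v O u \<in> R `` {v O u}"
      using equiv_class_self[OF equiv_PC_rel] u(1) v(1) by (blast intro: cofinite_homeos_comp)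
    then show ?thesis
      using PC_mult[OF u(1) v(1)] u(2) v(2) by metis
  qed
  then show ?thesis
    unfolding alpha_S_def by (auto simp: relcomp_unfold intro: UnionI)
qed

lemma subgroup_S_partial_action:
  assumes H: "subgroup H (PC X \<H>)"
  shows "S_partial_action (PC X \<H>\<lparr>carrier := H\<rparr>) X alpha_S A S \<H>"
proof -
  have HG: "H \<subseteq> carrier (PC X \<H>)" using H by (rule subgroup.subset)
  interpret group "PC X \<H>\<lparr>carrier := H\<rparr>"
    using H group_PC by (rule subgroup.subgroup_is_group)
  show ?thesis
  proof
    fix g assume "g \<in> carrier (PC X \<H>\<lparr>carrier := H\<rparr>)"
    then have gH: "g \<in> H" and g: "g \<in> carrier (PC X \<H>)" using HG by auto
    show "alpha_S g \<in> I_S X \<H> X \<H>" using g by (rule alpha_S_I_S)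
    then show "alpha_S g \<in> I_top X X" by (rule I_S_I_top)
    show "alpha_S (inv\<^bsub>PC X \<H>\<lparr>carrier := H\<rparr>\<^esub> g) = (alpha_S g)\<inverse>"
      using group.m_inv_consistent[OF group_PC H gH] alpha_S_inverse[OF g] by simp
    fix h assume "h \<in> carrier (PC X \<H>\<lparr>carrier := H\<rparr>)"
    then show "alpha_S h O alpha_S g \<subseteq> alpha_S (g \<otimes>\<^bsub>PC X \<H>\<lparr>carrier := H\<rparr>\<^esub> h)"
      using alpha_S_mult[OF g] HG by auto
  qed (use alpha_S_one pseudogroup is_structure in auto)
qed

end

lemma S_partial_action_restrict:
  assumes "S_partial_action G X \<alpha> A S \<H>" and Y: "openin X Y"
  shows "S_partial_action G (subtopology X Y) (restrict_paction \<alpha> Y) A S (restrict_structure \<H> Y)"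
proof -
  interpret S_partial_action G X \<alpha> A S \<H> by fact
  have top: "topspace (subtopology X Y) = Y"
    using openin_subset[OF Y] by auto
  show ?thesis
  proof
    fix g assume g: "g \<in> carrier G"
    show pres: "restrict_paction \<alpha> Y g \<in>
        I_S (subtopology X Y) (restrict_structure \<H> Y) (subtopology X Y) (restrict_structure \<H> Y)"
      unfolding restrict_paction_def
      using pseudogroup is_structure Y preserving[OF g] by (rule I_S_restrict)
    then show "restrict_paction \<alpha> Y g \<in> I_top (subtopology X Y) (subtopology X Y)"
      by (rule I_S_I_top)
    show "restrict_paction \<alpha> Y (inv\<^bsub>G\<^esub> g) = (restrict_paction \<alpha> Y g)\<inverse>"
      using inverse[OF g] by (auto simp: restrict_paction_def)
    fix h assume "h \<in> carrier G"
    then show "restrict_paction \<alpha> Y h O restrict_paction \<alpha> Y g \<subseteq> restrict_paction \<alpha> Y (g \<otimes>\<^bsub>G\<^esub> h)"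
      using mult[OF g] by (auto simp: restrict_paction_def)
  next
    show "restrict_paction \<alpha> Y \<one>\<^bsub>G\<^esub> = Id_on (topspace (subtopology X Y))"
      unfolding top using openin_subset[OF Y] by (auto simp: restrict_paction_def one)
  qed (use pseudogroup is_structure Y S_structure_restrict_structure in auto)
qed

section \<open>Transfixed partial actions\<close>

text \<open>
  The case of two points of B. H. Neumann's lemma. If every element moves \<open>p\<close> or \<open>q\<close> into \<open>F\<close>, a
  coset of the stabilizer of \<open>p\<close> that moves \<open>p\<close> outside \<open>F\<close> moves \<open>q\<close> into \<open>F\<close>, so the stabilizer of
  \<open>p\<close> has a finite orbit at \<open>q\<close>; the elements that move \<open>p\<close> into \<open>F\<close> form finitely many such cosets.
\<close>

lemma (in group_action) two_infinite_orbits_avoid_finite: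
  assumes p: "p \<in> E" and q: "q \<in> E" and F: "finite F"
    and inf: "infinite (orbit G \<phi> p)" "infinite (orbit G \<phi> q)"
  shows "\<exists>g\<in>carrier G. \<phi> g p \<notin> F \<and> \<phi> g q \<notin> F"
proof (rule ccontr)
  interpret group G using group_hom group_hom.axioms(1) by blast
  assume "\<not> ?thesis"
  then have cover: "\<phi> g q \<in> F" if "g \<in> carrier G" "\<phi> g p \<notin> F" for g
    using that by blast
  have "\<not> orbit G \<phi> p \<subseteq> F" using inf(1) F finite_subset by blast
  then obtain h where h: "h \<in> carrier G" "\<phi> h p \<notin> F" by (auto simp: orbit_def)
  \<comment> \<open>The orbit of \<open>q\<close> under the stabilizer of \<open>p\<close>. For
    \<open>x\<close> in the stabilizer, \<open>h \<otimes> x\<close> moves \<open>p\<close> to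
    \<open>\<phi> h p\<close>, outside \<open>F\<close>, so it must move \<open>q\<close> into
    \<open>F\<close>.\<close>
  define Q where "Q = (\<lambda>x. \<phi> x q) ` {x \<in> carrier G. \<phi> x p = p}"
  have "Q \<subseteq> \<phi> (inv h) ` F"
  proof
    fix z assume "z \<in> Q"
    then obtain x where x: "x \<in> carrier G" "\<phi> x p = p" "z = \<phi> x q" by (auto simp: Q_def)
    then have "\<phi> (h \<otimes> x) p \<notin> F" using h p by (simp add: composition_rule)
    then have "\<phi> h z \<in> F" using cover[of "h \<otimes> x"] h x q by (simp add: composition_rule)
    moreover have "\<phi> (inv h) (\<phi> h z) = z"
      using h(1) x q element_image orbit_sym_aux by metis
    ultimately show "z \<in> \<phi> (inv h) ` F" by (metis imageI)
  qed
  then have "finite Q" using F finite_surj by blast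
  \<comment> \<open>A representative of the coset of elements moving \<open>p\<close> to
    \<open>f\<close>; its value is arbitrary when there is none.\<close>
  define r where "r f = (SOME g. g \<in> carrier G \<and> \<phi> g p = f)" for f
  have r: "r f \<in> carrier G \<and> \<phi> (r f) p = f" if "g \<in> carrier G" "\<phi> g p = f" for g f
    unfolding r_def using that by (intro someI[of "\<lambda>g. g \<in> carrier G \<and> \<phi> g p = f"]) simp
  have "orbit G \<phi> q \<subseteq> F \<union> (\<Union>f\<in>F. \<phi> (r f) ` Q)"
  proof
    fix z assume "z \<in> orbit G \<phi> q"
    then obtain g where g: "g \<in> carrier G" "z = \<phi> g q" by (auto simp: orbit_def)
    show "z \<in> F \<union> (\<Union>f\<in>F. \<phi> (r f) ` Q)"
    proof (cases "\<phi> g p \<in> F")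
      case True
      define k where "k = r (\<phi> g p)"
      have k: "k \<in> carrier G" "\<phi> k p = \<phi> g p" using r[OF g(1) refl] by (auto simp: k_def)
      have "\<phi> (inv k \<otimes> g) p = p"
        using k g p by (simp add: composition_rule orbit_sym_aux)
      then have "\<phi> (inv k \<otimes> g) q \<in> Q" using k g by (auto simp: Q_def)
      moreover have "\<phi> k (\<phi> (inv k \<otimes> g) q) = z"
        using k(1) g q by (simp add: composition_rule[symmetric] m_assoc[symmetric])
      ultimately have "z \<in> \<phi> k ` Q" by blast
      with True show ?thesis by (auto simp: k_def)
    qed (use cover g in blast)
  qed
  moreover have "finite (F \<union> (\<Union>f\<in>F. \<phi> (r f) ` Q))" using F \<open>finite Q\<close> by blast
  ultimately show False using inf(2) finite_subset by blast
qed

text \<open>An orbit disjoint from \<open>F\<close> imposes no condition, so with at most one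
  infinite orbit to care about it is enough that such an orbit is not contained in \<open>F\<close>.
  Two infinite orbits are the case of Neumann's lemma.\<close>

lemma (in group_action) avoid_finite_set:
  assumes p: "p \<in> E" and q: "q \<in> E" and F: "finite F"
    and "orbit G \<phi> p \<inter> F = {} \<or> infinite (orbit G \<phi> p)"
    and "orbit G \<phi> q \<inter> F = {} \<or> infinite (orbit G \<phi> q)"
  shows "\<exists>g\<in>carrier G. \<phi> g p \<notin> F \<and> \<phi> g q \<notin> F"
proof -
  interpret group G using group_hom group_hom.axioms(1) by blast
  have orb: "\<phi> g x \<in> orbit G \<phi> x" if "g \<in> carrier G" for g x
    using that by (auto simp: orbit_def)
  have move: "\<exists>g\<in>carrier G. \<phi> g x \<notin> F" if "infinite (orbit G \<phi> x)" for x
  proof (rule ccontr)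
    assume "\<not> ?thesis"
    then have "orbit G \<phi> x \<subseteq> F" by (auto simp: orbit_def)
    then show False using that F finite_subset by blast
  qed
  consider "orbit G \<phi> p \<inter> F = {}" "orbit G \<phi> q \<inter> F = {}"
    | "orbit G \<phi> p \<inter> F = {}" "infinite (orbit G \<phi> q)"
    | "infinite (orbit G \<phi> p)" "orbit G \<phi> q \<inter> F = {}"
    | "infinite (orbit G \<phi> p)" "infinite (orbit G \<phi> q)"
    using assms(4,5) by argo
  then show ?thesis
  proof cases
    case 1
    then show ?thesis using orb[OF one_closed] by blast
  next
    case 2
    obtain g where "g \<in> carrier G" "\<phi> g q \<notin> F" using move[OF 2(2)] by (rule bexE)
    then show ?thesis using orb 2(1) by blast
  next
    case 3
    obtain g where "g \<in> carrier G" "\<phi> g p \<notin> F" using move[OF 3(1)] by (rule bexE)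
    then show ?thesis using orb 3(2) by blast
  next
    case 4
    then show ?thesis using two_infinite_orbits_avoid_finite[OF p q F] by blast
  qed
qed

text \<open>The third property will make \<open>Y\<close> cofinite in its own globalization. The
  last one asks for values in \<open>Y\<close>, and not merely in \<open>X\<close>, so that it
  speaks about the partial action restricted to \<open>Y\<close>.\<close>

lemma (in partial_action) transfixed_cofinite_subset:
  assumes "transfixed G X \<alpha>"
  obtains Y where "Y \<subseteq> topspace X" "finite (topspace X - Y)"
    "finite ((\<Union>h\<in>carrier G. proj h ` Y) - proj \<one> ` Y)"
    "\<And>h x k y. h \<in> carrier G \<Longrightarrow> x \<in> Y \<Longrightarrow> k \<in> carrier G \<Longrightarrow> y \<in> Y \<Longrightarrow>
      \<exists>g\<in>carrier G. \<exists>x'\<in>Y. \<exists>y'\<in>Y. (x, x') \<in> \<alpha> (g \<otimes> h) \<and> (y, y') \<in> \<alpha> (g \<otimes> k)"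
proof -
  let ?act = "glob_act G X \<alpha>" and ?i = "proj \<one>"
  let ?orb = "orbit G ?act"
  have i: "glob_embed G X \<alpha> = ?i" by (simp add: glob_embed_def[abs_def])
  obtain X\<^sub>0 where X0: "X\<^sub>0 \<subseteq> topspace (glob G X \<alpha>)" "\<forall>g\<in>carrier G. ?act g ` X\<^sub>0 = X\<^sub>0"
    and symm: "finite (sym_diff (?i ` topspace X) X\<^sub>0)"
    using assms unfolding transfixed_def i by (elim exE conjE)
  have fin: "finite (?i ` topspace X - X\<^sub>0)" "finite (X\<^sub>0 - ?i ` topspace X)"
    using symm by simp_all
  define F where "F = X\<^sub>0 - ?i ` topspace X"
  have F: "finite F" "F \<subseteq> topspace (glob G X \<alpha>)" using fin X0 by (auto simp: F_def)
  \<comment> \<open>Finitely many finite orbits: \<open>E\<close> is finite, and as a union of whole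
    orbits it can be removed without losing invariance.\<close>
  define E where "E = \<Union>(?orb ` {f \<in> F. finite (?orb f)})"
  have finE: "finite E" using F by (simp add: E_def)
  define W where "W = X\<^sub>0 - E"
  have W: "W \<subseteq> topspace (glob G X \<alpha>)" using X0 by (auto simp: W_def)
  have E_inv: "?act g e \<in> E" if g: "g \<in> carrier G" and e: "e \<in> E" for g e
  proof -
    obtain f h where f: "f \<in> F" "finite (?orb f)" and h: "h \<in> carrier G" "e = ?act h f"
      using e by (auto simp: E_def orbit_def)
    then have "?act g e = ?act (g \<otimes> h) f"
      using F(2) g glob.composition_rule[of f g h] by auto
    then have "?act g e \<in> ?orb f" using g h by (auto simp: orbit_def)
    then show ?thesis using f by (auto simp: E_def)
  qed
  have W_inv: "?act g w \<in> W" if g: "g \<in> carrier G" and w: "w \<in> W" for g w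
  proof -
    have "?act g w \<in> X\<^sub>0" using X0(2) g w by (auto simp: W_def)
    moreover have "?act (inv g) (?act g w) = w"
      using glob.orbit_sym_aux[OF g] W w by blast
    ultimately show ?thesis
      using E_inv[of "inv g" "?act g w"] g w by (auto simp: W_def)
  qed
  have W_orbit: "?orb p \<inter> F = {} \<or> infinite (?orb p)" if p: "p \<in> W" for p
  proof (rule disjCI)
    assume "\<not> infinite (?orb p)"
    have pt: "p \<in> topspace (glob G X \<alpha>)" using p W by blast
    \<comment> \<open>If a finite orbit of \<open>p\<close> met \<open>F\<close> in
      \<open>f\<close>, then \<open>p\<close> would lie in the finite orbit of \<open>f\<close>,
      hence in \<open>E\<close>.\<close>
    have False if f: "f \<in> ?orb p" "f \<in> F" for f
    proof -
      have ft: "f \<in> topspace (glob G X \<alpha>)" using f(2) F by blast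
      have "p \<in> ?orb f" using glob.orbit_sym[OF pt ft f(1)] .
      moreover have "?orb f \<subseteq> ?orb p"
      proof
        fix z assume z: "z \<in> ?orb f"
        then have "z \<in> topspace (glob G X \<alpha>)"
          using glob.element_image[OF _ ft refl] by (auto simp: orbit_def)
        then show "z \<in> ?orb p" using glob.orbit_trans[OF pt ft _ f(1) z] by blast
      qed
      ultimately have "p \<in> E"
        using \<open>\<not> infinite (?orb p)\<close> f(2) finite_subset by (auto simp: E_def)
      then show False using p by (simp add: W_def)
    qed
    then show "?orb p \<inter> F = {}" by blast
  qed
  define Y where "Y = {x \<in> topspace X. ?i x \<in> W}"
  \<comment> \<open>A point of \<open>W\<close> lies in \<open>X\<^sub>0\<close>, so outside
    \<open>F\<close> it belongs to the copy of \<open>X\<close>, and then to that of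
    \<open>Y\<close>.\<close>
  have W_Y: "\<exists>y\<in>Y. p = ?i y" if "p \<in> W" "p \<notin> F" for p
    using that by (auto simp: W_def F_def Y_def)
  have inj: "inj_on ?i (topspace X)"
    by (auto simp: inj_on_def proj_eq_iff one)
  show thesis
  proof
    show Yt: "Y \<subseteq> topspace X" by (auto simp: Y_def)
    \<comment> \<open>A point of \<open>X\<close> is lost either because it is missing from
      \<open>X\<^sub>0\<close> or because it lies in \<open>E\<close>; both sets are finite and the
      embedding is injective.\<close>
    have "topspace X - Y \<subseteq> ?i -` ((?i ` topspace X - X\<^sub>0) \<union> E) \<inter> topspace X"
      by (auto simp: Y_def W_def)
    moreover have "finite (?i -` ((?i ` topspace X - X\<^sub>0) \<union> E) \<inter> topspace X)"
      using fin(1) finE inj by (intro finite_vimage_IntI) auto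
    ultimately show "finite (topspace X - Y)" by (rule finite_subset)
    have WY: "proj h y \<in> W" if "h \<in> carrier G" "y \<in> Y" for h y
      using W_inv[OF that(1), of "?i y"] that by (simp add: Y_def glob_act_proj)
    \<comment> \<open>Translates of \<open>Y\<close> stay in the invariant set \<open>W\<close>,
      whose points outside \<open>F\<close> lie in the copy of \<open>Y\<close>.\<close>
    have "(\<Union>h\<in>carrier G. proj h ` Y) - ?i ` Y \<subseteq> F"
      using WY W_Y by blast
    then show "finite ((\<Union>h\<in>carrier G. proj h ` Y) - ?i ` Y)"
      using F(1) by (rule finite_subset)
    fix h x k y assume hk: "h \<in> carrier G" "x \<in> Y" "k \<in> carrier G" "y \<in> Y"
    have pq: "proj h x \<in> W" "proj k y \<in> W" using WY hk by auto
    then obtain g where g: "g \<in> carrier G" "?act g (proj h x) \<notin> F" "?act g (proj k y) \<notin> F"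
      using glob.avoid_finite_set[OF _ _ F(1) W_orbit[OF pq(1)] W_orbit[OF pq(2)]] W by blast
    obtain x' y' where x'y': "x' \<in> Y" "?act g (proj h x) = ?i x'" "y' \<in> Y" "?act g (proj k y) = ?i y'"
      using W_Y[OF W_inv[OF g(1) pq(1)] g(2)] W_Y[OF W_inv[OF g(1) pq(2)] g(3)] by blast
    have top: "x \<in> topspace X" "y \<in> topspace X" "x' \<in> topspace X" "y' \<in> topspace X"
      using hk x'y' Yt by auto
    then have "proj (g \<otimes> h) x = ?i x'" "proj (g \<otimes> k) y = ?i y'"
      using x'y' g hk by (simp_all add: glob_act_proj)
    then have "(x, x') \<in> \<alpha> (g \<otimes> h)" "(y, y') \<in> \<alpha> (g \<otimes> k)"
      using top g hk by (simp_all add: proj_one_eq_iff)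
    then show "\<exists>g\<in>carrier G. \<exists>x'\<in>Y. \<exists>y'\<in>Y. (x, x') \<in> \<alpha> (g \<otimes> h) \<and> (y, y') \<in> \<alpha> (g \<otimes> k)"
      using g x'y' by blast
  qed
qed

section \<open>Passage from \<open>X\<close> to an open cofinite subspace\<close>

lemma I_S_from_open_subspace:
  assumes "u \<in> I_S (subtopology X U) (restrict_structure \<H> U) Y \<K>" and U: "openin X U"
  shows "u \<in> I_S X \<H> Y \<K>"
proof -
  obtain F where u: "u \<in> I_top (subtopology X U) Y" "u = \<Union>F"
    and F: "F \<subseteq> {a O b\<inverse> | a b. a \<in> restrict_structure \<H> U \<and> b \<in> \<K>}"
    using assms(1) by (rule I_SE) blast
  have "u \<in> I_top X Y"
    using u(1) I_top_subtopology[OF U openin_topspace[of Y]] by simp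
  moreover have "F \<subseteq> {a O b\<inverse> | a b. a \<in> \<H> \<and> b \<in> \<K>}"
    using F unfolding restrict_structure_def by blast
  ultimately show ?thesis using u(2) by (rule I_SI)
qed

text \<open>The finiteness is known for translates of \<open>Y\<close> inside the globalization of
  \<open>X\<close>. Classes of points of \<open>Y\<close> coincide there exactly when they do in the
  globalization of \<open>Y\<close>, so \<open>r\<close> is a well-defined map between the two and
  carries the finite set over.\<close>

lemma (in partial_action) restrict_glob_finite_complement:
  assumes "partial_action G (subtopology X Y) (restrict_paction \<alpha> Y)" and Y: "Y \<subseteq> topspace X"
    and fin: "finite ((\<Union>h\<in>carrier G. proj h ` Y) - proj \<one> ` Y)"
  shows "finite (topspace (glob G (subtopology X Y) (restrict_paction \<alpha> Y)) -
    Range (glob_embed_graph G (subtopology X Y) (restrict_paction \<alpha> Y)))"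
proof -
  interpret Y: partial_action G "subtopology X Y" "restrict_paction \<alpha> Y" by fact
  have top: "topspace (subtopology X Y) = Y" using Y by auto
  \<comment> \<open>Both equalities say that \<open>(x, y)\<close> lies in
    \<open>\<alpha> (inv k \<otimes> h)\<close>; restriction to pairs in \<open>Y\<close> changes
    nothing for points of \<open>Y\<close>.\<close>
  have eq_iff: "Y.proj h x = Y.proj k y \<longleftrightarrow> proj h x = proj k y"
    if "h \<in> carrier G" "x \<in> Y" "k \<in> carrier G" "y \<in> Y" for h x k y
    using that Y Y.proj_eq_iff[of h x k y] proj_eq_iff[of h x k y]
    by (auto simp only: top restrict_paction_def)
  define r where "r = {(proj h y, Y.proj h y) | h y. h \<in> carrier G \<and> y \<in> Y}"
  have "single_valued r"
    unfolding single_valued_def r_def using eq_iff by blast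
  moreover have "topspace (glob G (subtopology X Y) (restrict_paction \<alpha> Y)) -
      Range (glob_embed_graph G (subtopology X Y) (restrict_paction \<alpha> Y))
    \<subseteq> r `` ((\<Union>h\<in>carrier G. proj h ` Y) - proj \<one> ` Y)"
  proof
    fix c assume c: "c \<in> topspace (glob G (subtopology X Y) (restrict_paction \<alpha> Y)) -
      Range (glob_embed_graph G (subtopology X Y) (restrict_paction \<alpha> Y))"
    then obtain h y where hy: "h \<in> carrier G" "y \<in> Y" "c = Y.proj h y"
      using Y.globE top by (metis DiffD1)
    have "proj h y \<noteq> proj \<one> z" if z: "z \<in> Y" for z
    proof
      assume "proj h y = proj \<one> z"
      then have "c = Y.proj \<one> z" using eq_iff[OF hy(1,2) one_closed z] hy(3) by simp
      then have "(z, c) \<in> glob_embed_graph G (subtopology X Y) (restrict_paction \<alpha> Y)"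
        using z Y by (simp add: Y.glob_embed_graph_eq Y.embed_at_iff subsetD)
      then show False using c by blast
    qed
    then have "proj h y \<in> (\<Union>h\<in>carrier G. proj h ` Y) - proj \<one> ` Y"
      using hy by blast
    moreover have "(proj h y, c) \<in> r" using hy by (auto simp: r_def)
    ultimately show "c \<in> r `` ((\<Union>h\<in>carrier G. proj h ` Y) - proj \<one> ` Y)" by blast
  qed
  ultimately show ?thesis
    using fin finite_Image_single_valued finite_subset by metis
qed

theorem theorem2p2:
  fixes A :: "'a topology" and S :: "('a \<times> 'a) set set"
    and X :: "'x topology" and \<H> :: "('x \<times> 'a) set set"
    and H :: "('x \<times> 'x) set set set"
  assumes "Hausdorff_space A" and "\<forall>a\<in>topspace A. \<not> openin A {a}"
    and "pseudogroup A S"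
    and "Hausdorff_space X" and "S_structure A S X \<H>"
    and "subgroup H (PC X \<H>)"
    and "transfixed (PC X \<H>\<lparr>carrier := H\<rparr>) X alpha_S"
  shows "\<exists>Y \<subseteq> topspace X. finite (topspace X - Y) \<and>
    (let G = PC X \<H>\<lparr>carrier := H\<rparr>;
         XY = subtopology X Y;
         \<alpha> = restrict_paction alpha_S Y;
         Y' = glob G XY \<alpha>;
         \<phi> = glob_embed_graph G XY \<alpha>;
         act = glob_act_graph G XY \<alpha>
     in Hausdorff_space Y' \<and>
        (\<exists>\<K>. glob_structure A S G XY (restrict_structure \<H> Y) \<alpha> \<K> \<and>
             \<phi> \<in> I_S X \<H> Y' \<K> \<and> finite (topspace Y' - Range \<phi>) \<and>
             group_action G (topspace Y') (glob_act G XY \<alpha>) \<and>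
             (\<forall>h\<in>H. act h \<in> I_S Y' \<K> Y' \<K>) \<and>
             (\<forall>h\<in>H. \<forall>u\<in>h. (\<phi> \<circ>\<^sub>p u \<circ>\<^sub>p \<phi>\<inverse>, act h) \<in> PC_rel Y' \<K>)))"
proof -
  interpret X: S_modeled_Hausdorff A S X \<H>
    using assms S_structure_no_isolated_points by unfold_locales blast+
  let ?G = "PC X \<H>\<lparr>carrier := H\<rparr>"
  have H: "H \<subseteq> carrier (PC X \<H>)" using assms(6) by (rule subgroup.subset)
  interpret \<alpha>: S_partial_action ?G X alpha_S A S \<H>
    using assms(6) by (rule X.subgroup_S_partial_action)
  obtain Y where Y: "Y \<subseteq> topspace X" "finite (topspace X - Y)"
    and fin: "finite ((\<Union>h\<in>carrier ?G. \<alpha>.proj h ` Y) - \<alpha>.proj \<one>\<^bsub>?G\<^esub> ` Y)"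
    and move: "\<And>h x k y. h \<in> carrier ?G \<Longrightarrow> x \<in> Y \<Longrightarrow> k \<in> carrier ?G \<Longrightarrow> y \<in> Y \<Longrightarrow>
      \<exists>g\<in>carrier ?G. \<exists>x'\<in>Y. \<exists>y'\<in>Y.
        (x, x') \<in> alpha_S (g \<otimes>\<^bsub>?G\<^esub> h) \<and> (y, y') \<in> alpha_S (g \<otimes>\<^bsub>?G\<^esub> k)"
    using assms(7) by (rule \<alpha>.transfixed_cofinite_subset) blast
  have openY: "openin X Y" using assms(4) Y by (rule openin_cofinite)
  let ?XY = "subtopology X Y" and ?\<beta> = "restrict_paction alpha_S Y"
  have top: "topspace ?XY = Y" using Y(1) by auto
  interpret \<beta>: S_partial_action ?G ?XY ?\<beta> A S "restrict_structure \<H> Y"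
    using \<alpha>.S_partial_action_axioms openY by (rule S_partial_action_restrict)
  let ?Y' = "glob ?G ?XY ?\<beta>" and ?\<phi> = "glob_embed_graph ?G ?XY ?\<beta>"
    and ?K = "\<beta>.glob_charts" and ?act = "glob_act_graph ?G ?XY ?\<beta>"
  have Haus: "Hausdorff_space ?Y'"
  proof (rule \<beta>.Hausdorff_glob)
    show "Hausdorff_space ?XY" using assms(4) by (rule Hausdorff_space_subtopology)
    fix h x k y
    assume "h \<in> carrier ?G" "x \<in> topspace ?XY" "k \<in> carrier ?G" "y \<in> topspace ?XY"
    then obtain g x' y' where g: "g \<in> carrier ?G"
      and *: "(x, x') \<in> ?\<beta> (g \<otimes>\<^bsub>?G\<^esub> h)" "(y, y') \<in> ?\<beta> (g \<otimes>\<^bsub>?G\<^esub> k)"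
      using move[of h x k y] unfolding top restrict_paction_def by blast
    show "\<exists>g\<in>carrier ?G. x \<in> Domain (?\<beta> (g \<otimes>\<^bsub>?G\<^esub> h)) \<and> y \<in> Domain (?\<beta> (g \<otimes>\<^bsub>?G\<^esub> k))"
      using g DomainI[OF *(1)] DomainI[OF *(2)] by blast
  qed
  interpret Y': S_modeled_Hausdorff A S ?Y' ?K
    using assms(2,3) Haus \<beta>.S_structure_glob_charts
      S_structure_no_isolated_points[OF \<beta>.S_structure_glob_charts]
    by unfold_locales blast+
  \<comment> \<open>The embedding starts from \<open>Y\<close>, but charts of the open subspace
    \<open>Y\<close> are charts of \<open>X\<close>, so it is also a partial homeomorphism from
    \<open>X\<close>.\<close>
  have \<phi>: "?\<phi> \<in> I_S X \<H> ?Y' ?K"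
    using \<beta>.embed_at_I_S[OF \<alpha>.one_closed] openY unfolding \<beta>.glob_embed_graph_eq
    by (rule I_S_from_open_subspace)
  have fin': "finite (topspace ?Y' - Range ?\<phi>)"
    using \<beta>.partial_action_axioms Y(1) fin by (rule \<alpha>.restrict_glob_finite_complement)
  have sv: "single_valued ?\<phi>"
    using I_S_I_top[OF \<phi>] by (simp add: I_top_iff)
  have \<phi>_iff: "(x, c) \<in> ?\<phi> \<longleftrightarrow> x \<in> Y \<and> c = \<beta>.proj \<one>\<^bsub>?G\<^esub> x" for x c
    unfolding \<beta>.glob_embed_graph_eq \<beta>.embed_at_iff top ..
  have act: "?act h \<in> cofinite_homeos ?Y' ?K" if h: "h \<in> H" for h
  proof -
    have "Domain (?act h) = topspace ?Y'" by (auto simp: \<beta>.glob_act_graph_iff)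
    moreover have "Range (?act h) = glob_act ?G ?XY ?\<beta> h ` topspace ?Y'"
      by (auto simp: \<beta>.glob_act_graph_iff)
    ultimately show ?thesis
      using h \<beta>.glob_act_I_S[of h] \<beta>.glob.surj_prop[of h] by (simp add: cofinite_homeos_def)
  qed
  have "(?\<phi>\<inverse> O (u O ?\<phi>), ?act h) \<in> PC_rel ?Y' ?K" if h: "h \<in> H" and u: "u \<in> h" for h u
  proof -
    let ?w = "?\<phi>\<inverse> O (u O ?\<phi>)"
    have uCH: "u \<in> cofinite_homeos X \<H>" using X.PC_memberD(1) H h u by blast
    note u' = X.cofinite_homeosD[OF uCH]
    have "u O ?\<phi> \<in> I_S X \<H> ?Y' ?K"
      using X.is_structure X.is_structure Y'.is_structure u'(1) \<phi> by (rule I_S_comp)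
    with Y'.is_structure X.is_structure Y'.is_structure I_S_converse[OF \<phi>]
    have "?w \<in> I_S ?Y' ?K ?Y' ?K" by (rule I_S_comp)
    moreover have "finite (topspace ?Y' - Domain ?w)"
    proof (rule finite_subset)
      \<comment> \<open>At a point outside the copy of \<open>Y\<close> the conjugate is undefined;
        at the copy of some \<open>x\<close> in \<open>Y\<close> it fails only if \<open>u\<close>
        is undefined at \<open>x\<close> or moves \<open>x\<close> out of \<open>Y\<close>.\<close>
      show "topspace ?Y' - Domain ?w \<subseteq>
        (topspace ?Y' - Range ?\<phi>) \<union> ?\<phi> `` (topspace X - Domain u) \<union> ?\<phi> `` (u\<inverse> `` (topspace X - Y))"
      proof
        fix c assume c: "c \<in> topspace ?Y' - Domain ?w"
        show "c \<in> (topspace ?Y' - Range ?\<phi>) \<union> ?\<phi> `` (topspace X - Domain u) \<union>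
          ?\<phi> `` (u\<inverse> `` (topspace X - Y))"
        proof (rule ccontr)
          assume n: "\<not> ?thesis"
          then obtain x where x: "(x, c) \<in> ?\<phi>" using c by blast
          then have "x \<in> topspace X" using Y(1) \<phi>_iff by blast
          then obtain y where y: "(x, y) \<in> u" using n x by blast
          then have "y \<in> Y" using n x u'(3) by blast
          then have "(y, \<beta>.proj \<one>\<^bsub>?G\<^esub> y) \<in> ?\<phi>" using \<phi>_iff by simp
          then show False using c x y by blast
        qed
      qed
      show "finite \<dots>"
        using fin' sv u' Y(2) by (simp add: finite_Image_single_valued)
    qed
    moreover have "finite (topspace ?Y' - Range ?w)"
    proof (rule finite_subset)
      show "topspace ?Y' - Range ?w \<subseteq>
        (topspace ?Y' - Range ?\<phi>) \<union> ?\<phi> `` (topspace X - Range u) \<union> ?\<phi> `` (u `` (topspace X - Y))"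
      proof
        fix c assume c: "c \<in> topspace ?Y' - Range ?w"
        show "c \<in> (topspace ?Y' - Range ?\<phi>) \<union> ?\<phi> `` (topspace X - Range u) \<union>
          ?\<phi> `` (u `` (topspace X - Y))"
        proof (rule ccontr)
          assume n: "\<not> ?thesis"
          then obtain y where y: "(y, c) \<in> ?\<phi>" using c by blast
          then have "y \<in> topspace X" using Y(1) \<phi>_iff by blast
          then obtain x where x: "(x, y) \<in> u" using n y by blast
          then have "x \<in> Y" using n y u'(3) by blast
          then have "(x, \<beta>.proj \<one>\<^bsub>?G\<^esub> x) \<in> ?\<phi>" using \<phi>_iff by simp
          then show False using c x y by blast
        qed
      qed
      show "finite \<dots>"
        using fin' sv u' Y(2) by (simp add: finite_Image_single_valued)
    qed
    ultimately have "?w \<in> cofinite_homeos ?Y' ?K"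
      by (simp add: cofinite_homeos_def)
    \<comment> \<open>By \<open>PC_rel_iff\<close> a comparison on the common domain suffices. If
      \<open>u\<close> moves \<open>x\<close> to \<open>y\<close> inside \<open>Y\<close>, the
      restricted partial action identifies the translate of \<open>x\<close> by \<open>h\<close>
      with the copy of \<open>y\<close>, which is the value of both maps.\<close>
    moreover have "d = d'" if d: "(c, d) \<in> ?w" and d': "(c, d') \<in> ?act h" for c d d'
    proof -
      obtain x y where xy: "(x, c) \<in> ?\<phi>" "(x, y) \<in> u" "(y, d) \<in> ?\<phi>" using d by blast
      then have Yxy: "x \<in> Y" "y \<in> Y" "c = \<beta>.proj \<one>\<^bsub>?G\<^esub> x" "d = \<beta>.proj \<one>\<^bsub>?G\<^esub> y"
        using \<phi>_iff by blast+
      then have "(x, y) \<in> ?\<beta> h"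
        using xy(2) u by (auto simp: restrict_paction_def alpha_S_def)
      then have "\<beta>.proj h x = d"
        using Yxy h top \<beta>.proj_one_eq_iff[of h x y] by simp
      moreover have "d' = \<beta>.proj h x"
        using d' h Yxy top \<beta>.glob_act_proj[of h "\<one>\<^bsub>?G\<^esub>" x] \<alpha>.r_one[of h] \<alpha>.one_closed
        by (simp add: \<beta>.glob_act_graph_iff)
      ultimately show ?thesis by simp
    qed
    ultimately show ?thesis
      using act[OF h] Y'.PC_rel_iff by blast
  qed
  then show ?thesis
    unfolding Let_def
    using Y Haus \<beta>.glob_structure_glob_charts \<phi> fin' \<beta>.glob_act_group_action \<beta>.glob_act_I_S
    by (intro exI[of _ Y] conjI exI[of _ ?K]) auto
qed

end
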